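(* Let $\phi:\mathbb{C}_{1/2}\to\mathbb{C}_{1/2}$ be analytic such that the composition operator $C_\phi f=f\circ\phi$ is a continuous operator on $\mathcal{H}$. Then $C_\phi$ is recurrent if and only if $\phi(s)=s+it$ for some $t\in\mathbb{R}$. Moreover, if $C_\phi$ is recurrent, then $C_\phi$ is hyper-recurrent and $\mathrm{Hr}(C_\phi)$ is dense in $\mathcal{H}$.
   Context: $\mathbb{C}_\theta=\{s\in\mathbb{C}:\mathrm{Re}(s)>\theta\}$. $\mathcal{H}$ is the Hardy space of Dirichlet series: the Hilbert space of functions $f(s)=\sum_{n\ge1}a_nn^{-s}$ with $\|f\|=(\sum_n|a_n|^2)^{1/2}<\infty$, viewed as holomorphic functions on $\mathbb{C}_{1/2}$. For a bounded operator $T$: $x$ is recurrent if $T^{\omega_n}x\to x$ for some strictly increasing sequence $(\omega_n)$ of positive integers; $\mathrm{Rec}(T)$ is the set of recurrent vectors and $T$ is recurrent if $\mathrm{Rec}(T)$ is dense. $\mathfrak{C}$ is the set of strictly increasing sequences $\omega$ with $T^{\omega_n}x\to x$ for some $x\ne0$; $\mathfrak{L}(\omega)=\{x:T^{\omega_n}x\to x\}$. $\mathrm{Hr}(T)$ is the set of $x\in\mathrm{Rec}(T)$ such that $\mathfrak{L}(\omega)$ is dense for every $\omega\in\mathfrak{C}$ with $x\in\mathfrak{L}(\omega)$; a recurrent $T$ is hyper-recurrent if $\mathrm{Hr}(T)\ne\emptyset$. *)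

theory Defs
  imports "HOL-Analysis.Analysis"
begin

text \<open>The Hardy space of Dirichlet series, represented by coefficient sequences
  a :: nat => complex (index 0 unused, forced to be 0) with square-summable moduli.\<close>

definition half_plane :: "real \<Rightarrow> complex set" where
  "half_plane \<theta> = {s. Re s > \<theta>}"

definition Hdir :: "(nat \<Rightarrow> complex) set" where
  "Hdir = {a. a 0 = 0 \<and> summable (\<lambda>n. (cmod (a n))\<^sup>2)}"

definition hnorm :: "(nat \<Rightarrow> complex) \<Rightarrow> real" where
  "hnorm a = sqrt (\<Sum>n. (cmod (a n))\<^sup>2)"

definition dir_eval :: "(nat \<Rightarrow> complex) \<Rightarrow> complex \<Rightarrow> complex" where
  "dir_eval a s = (\<Sum>n. a n * (of_nat n) powr (- s))"

definition comp_maps_H :: "(complex \<Rightarrow> complex) \<Rightarrow> bool" where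
  "comp_maps_H \<phi> \<longleftrightarrow> (\<forall>a\<in>Hdir. \<exists>b\<in>Hdir. \<forall>s\<in>half_plane (1/2). dir_eval b s = dir_eval a (\<phi> s))"

definition comp_op :: "(complex \<Rightarrow> complex) \<Rightarrow> (nat \<Rightarrow> complex) \<Rightarrow> (nat \<Rightarrow> complex)" where
  "comp_op \<phi> a = (SOME b. b \<in> Hdir \<and> (\<forall>s\<in>half_plane (1/2). dir_eval b s = dir_eval a (\<phi> s)))"

text \<open>C_phi is a continuous (= bounded, it is linear) operator on H.\<close>
definition comp_op_bounded :: "(complex \<Rightarrow> complex) \<Rightarrow> bool" where
  "comp_op_bounded \<phi> \<longleftrightarrow> comp_maps_H \<phi> \<and>
     (\<exists>C. \<forall>a\<in>Hdir. hnorm (comp_op \<phi> a) \<le> C * hnorm a)"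

definition hdense :: "(nat \<Rightarrow> complex) set \<Rightarrow> bool" where
  "hdense S \<longleftrightarrow> S \<subseteq> Hdir \<and> (\<forall>a\<in>Hdir. \<forall>\<epsilon>>0. \<exists>x\<in>S. hnorm (\<lambda>n. x n - a n) < \<epsilon>)"

definition iter_conv :: "((nat \<Rightarrow> complex) \<Rightarrow> (nat \<Rightarrow> complex)) \<Rightarrow> (nat \<Rightarrow> nat) \<Rightarrow> (nat \<Rightarrow> complex) \<Rightarrow> bool" where
  "iter_conv T \<omega> x \<longleftrightarrow> ((\<lambda>k. hnorm (\<lambda>n. (T ^^ \<omega> k) x n - x n)) \<longlonglongrightarrow> 0)"

definition admissible_seq :: "(nat \<Rightarrow> nat) \<Rightarrow> bool" where
  "admissible_seq \<omega> \<longleftrightarrow> strict_mono \<omega> \<and> (\<forall>k. \<omega> k > 0)"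

definition Rec :: "((nat \<Rightarrow> complex) \<Rightarrow> (nat \<Rightarrow> complex)) \<Rightarrow> (nat \<Rightarrow> complex) set" where
  "Rec T = {x\<in>Hdir. \<exists>\<omega>. admissible_seq \<omega> \<and> iter_conv T \<omega> x}"

definition recurrent :: "((nat \<Rightarrow> complex) \<Rightarrow> (nat \<Rightarrow> complex)) \<Rightarrow> bool" where
  "recurrent T \<longleftrightarrow> hdense (Rec T)"

definition Lset :: "((nat \<Rightarrow> complex) \<Rightarrow> (nat \<Rightarrow> complex)) \<Rightarrow> (nat \<Rightarrow> nat) \<Rightarrow> (nat \<Rightarrow> complex) set" where
  "Lset T \<omega> = {x\<in>Hdir. iter_conv T \<omega> x}"

definition Cseqs :: "((nat \<Rightarrow> complex) \<Rightarrow> (nat \<Rightarrow> complex)) \<Rightarrow> (nat \<Rightarrow> nat) set" where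
  "Cseqs T = {\<omega>. admissible_seq \<omega> \<and> (\<exists>x\<in>Lset T \<omega>. x \<noteq> (\<lambda>_. 0))}"

definition Hr :: "((nat \<Rightarrow> complex) \<Rightarrow> (nat \<Rightarrow> complex)) \<Rightarrow> (nat \<Rightarrow> complex) set" where
  "Hr T = {x\<in>Rec T. \<forall>\<omega>\<in>Cseqs T. x \<in> Lset T \<omega> \<longrightarrow> hdense (Lset T \<omega>)}"

definition hyper_recurrent :: "((nat \<Rightarrow> complex) \<Rightarrow> (nat \<Rightarrow> complex)) \<Rightarrow> bool" where
  "hyper_recurrent T \<longleftrightarrow> recurrent T \<and> Hr T \<noteq> {}"

end

theory Submission
  imports Defs "HOL-Complex_Analysis.Complex_Analysis"
begin

text \<open>
  Let \<open>T = C\<^sub>\<phi>\<close> be recurrent and write \<open>2\<^sup>-\<^sup>\<phi> = \<Sum> b\<^sub>n n\<^sup>-\<^sup>s\<close>. If \<open>b\<^sub>1 \<noteq> 0\<close>, then \<open>\<phi>\<close> tends to a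
  finite point along the positive real axis and the coefficients of \<open>T f\<close> at \<open>2\<close> and \<open>3\<close> are
  proportional to \<open>b\<^sub>2\<close> and \<open>b\<^sub>3\<close>, so the range of \<open>T\<close> is not dense, which is impossible. If
  \<open>b\<^sub>1 = 0\<close>, then the second coefficient functional is an eigenvector of the adjoint of \<open>T\<close> with
  eigenvalue \<open>b\<^sub>2\<close>, so recurrence forces \<open>|b\<^sub>2| = 1\<close>. Hence \<open>\<phi> x - x\<close> converges to an imaginary
  number exponentially fast, and Julia's lemma together with Harnack's inequality on the half-plane
  shows that \<open>\<phi> s - s\<close> is constant. Conversely, a vertical translation acts diagonally by unimodular
  factors \<open>n\<^sup>-\<^sup>i\<^sup>t\<close>, which return to \<open>1\<close> simultaneously; any vector without vanishing coefficients
  detects such a sequence of return times.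
\<close>

section \<open>Square-summable Dirichlet series\<close>

lemma Hdir_0: "a \<in> Hdir \<Longrightarrow> a 0 = 0"
  by (simp add: Hdir_def)

lemma summable_Hdir: "a \<in> Hdir \<Longrightarrow> summable (\<lambda>n. (cmod (a n))\<^sup>2)"
  by (simp add: Hdir_def)

lemma Hdir_add:
  assumes "a \<in> Hdir" "b \<in> Hdir"
  shows "(\<lambda>n. a n + b n) \<in> Hdir"
proof -
  have le: "(cmod (a n + b n))\<^sup>2 \<le> 2 * (cmod (a n))\<^sup>2 + 2 * (cmod (b n))\<^sup>2" for n
  proof -
    have "(cmod (a n + b n))\<^sup>2 \<le> (cmod (a n) + cmod (b n))\<^sup>2"
      by (intro power_mono norm_triangle_ineq) auto
    then show ?thesis
      using sum_squares_bound[of "cmod (a n)" "cmod (b n)"] by (simp add: power2_sum)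
  qed
  have sm: "summable (\<lambda>n. 2 * (cmod (a n))\<^sup>2 + 2 * (cmod (b n))\<^sup>2)"
    using assms by (intro summable_add summable_mult summable_Hdir)
  have "summable (\<lambda>n. (cmod (a n + b n))\<^sup>2)"
    by (rule summable_comparison_test'[OF sm, where N=0]) (use le in auto)
  then show ?thesis
    using assms by (simp add: Hdir_def)
qed

lemma Hdir_scale:
  assumes "a \<in> Hdir" shows "(\<lambda>n. c * a n) \<in> Hdir"
  using assms summable_mult[OF summable_Hdir[OF assms], of "(cmod c)\<^sup>2"]
  by (simp add: Hdir_def norm_mult power_mult_distrib)

lemma Hdir_diff:
  assumes "a \<in> Hdir" "b \<in> Hdir"
  shows "(\<lambda>n. a n - b n) \<in> Hdir"
  using Hdir_add[OF assms(1) Hdir_scale[OF assms(2), of "-1"]] by simp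

lemma Hdir_bounded_by:
  assumes "a \<in> Hdir" "\<And>n. cmod (b n) \<le> cmod (a n)"
  shows "b \<in> Hdir"
proof -
  have "summable (\<lambda>n. (cmod (b n))\<^sup>2)"
    using assms by (intro summable_comparison_test'[OF summable_Hdir[OF assms(1)], where N=0])
      (auto intro!: power_mono)
  then show ?thesis
    using assms(2)[of 0] Hdir_0[OF assms(1)] by (simp add: Hdir_def)
qed

lemma Hdir_finite_support:
  assumes "a 0 = 0" "\<And>n. n \<ge> N \<Longrightarrow> a n = 0"
  shows "a \<in> Hdir"
proof -
  have "summable (\<lambda>n. (cmod (a n))\<^sup>2)"
    by (rule summable_finite[of "{..<N}"]) (use assms(2) in \<open>auto simp: not_less\<close>)
  then show ?thesis
    using assms(1) by (simp add: Hdir_def)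
qed

lemma cmod_le_hnorm:
  assumes "a \<in> Hdir" shows "cmod (a n) \<le> hnorm a"
proof -
  have "(cmod (a n))\<^sup>2 \<le> (\<Sum>n. (cmod (a n))\<^sup>2)"
    using sum_le_suminf[OF summable_Hdir[OF assms], of "{n}"] by simp
  then show ?thesis
    unfolding hnorm_def by (simp add: real_le_rsqrt)
qed

definition dir_unit :: "nat \<Rightarrow> nat \<Rightarrow> complex" where
  "dir_unit n = (\<lambda>m. if m = n then 1 else 0)"

lemma dir_unit_Hdir: "n > 0 \<Longrightarrow> dir_unit n \<in> Hdir"
  by (rule Hdir_finite_support[where N = "Suc n"]) (auto simp: dir_unit_def)

lemma dir_eval_unit: "dir_eval (dir_unit n) s = of_nat n powr (- s)"
proof -
  have "(\<lambda>m. dir_unit n m * of_nat m powr (- s)) sums (\<Sum>m\<in>{n}. dir_unit n m * of_nat m powr (- s))"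
    by (rule sums_finite) (auto simp: dir_unit_def)
  then show ?thesis
    by (simp add: dir_eval_def dir_unit_def sums_iff)
qed

lemma norm_of_nat_powr: "cmod (of_nat n powr s) = real n powr Re s"
  by (subst norm_powr_real_powr) auto

text \<open>With \<sigma> = Re s, each term satisfies |a_n| n^(-\<sigma>) <= |a_n|^2 +
  n^(-2\<sigma>), and the second sum converges because 2\<sigma> > 1.\<close>

lemma dir_eval_abs_summable:
  assumes "a \<in> Hdir" "Re s > 1/2"
  shows "summable (\<lambda>n. cmod (a n * of_nat n powr (- s)))"
proof (rule summable_comparison_test'[where N=0])
  show "summable (\<lambda>n. (cmod (a n))\<^sup>2 + real n powr (- 2 * Re s))"
    using assms by (intro summable_add summable_Hdir) (auto simp: summable_real_powr_iff)
  show "norm (cmod (a n * of_nat n powr (- s))) \<le> (cmod (a n))\<^sup>2 + real n powr (- 2 * Re s)" for n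
  proof -
    have "real n powr (- 2 * Re s) = (real n powr (- Re s))\<^sup>2"
      by (simp add: power2_eq_square flip: powr_add)
    moreover have "cmod (a n) * real n powr (- Re s)
        \<le> (cmod (a n))\<^sup>2 + (real n powr (- Re s))\<^sup>2"
      using sum_squares_bound[of "cmod (a n)" "real n powr (- Re s)"]
        mult_nonneg_nonneg[OF norm_ge_zero[of "a n"] powr_ge_zero[of "real n" "- Re s"]]
      unfolding mult.assoc by linarith
    ultimately show ?thesis
      by (simp add: norm_mult norm_of_nat_powr)
  qed
qed

lemma dir_eval_summable:
  assumes "a \<in> Hdir" "Re s > 1/2"
  shows "summable (\<lambda>n. a n * of_nat n powr (- s))"
  by (rule summable_norm_cancel[OF dir_eval_abs_summable[OF assms]])

lemma dir_eval_add:
  assumes "a \<in> Hdir" "b \<in> Hdir" "Re s > 1/2"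
  shows "dir_eval (\<lambda>n. a n + b n) s = dir_eval a s + dir_eval b s"
  using suminf_add[OF dir_eval_summable[OF assms(1,3)] dir_eval_summable[OF assms(2,3)]]
  by (simp add: dir_eval_def ring_distribs)

lemma dir_eval_scale:
  assumes "a \<in> Hdir" "Re s > 1/2"
  shows "dir_eval (\<lambda>n. c * a n) s = c * dir_eval a s"
  using suminf_mult[OF dir_eval_summable[OF assms], of c]
  by (simp add: dir_eval_def mult.assoc)

text \<open>Writing n^(-\<sigma>) = n^(-1) n^(1-\<sigma>) and bounding the second factor by its
  value at \<open>N\<close> leaves a series that converges absolutely at s = 1.\<close>

lemma dir_eval_tail_bound:
  assumes "a \<in> Hdir" "N > 0" "\<And>n. n < N \<Longrightarrow> a n = 0"
  shows "\<exists>K. \<forall>s. Re s \<ge> 1 \<longrightarrow> cmod (dir_eval a s) \<le> K * real N powr (- Re s)"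
proof (intro exI allI impI)
  fix s :: complex assume s: "Re s \<ge> 1"
  have sum1: "summable (\<lambda>n. cmod (a n) * real n powr (-1))"
    using dir_eval_abs_summable[OF assms(1), of 1] by (simp add: norm_mult norm_of_nat_powr)
  have le: "cmod (a n * of_nat n powr (- s))
      \<le> cmod (a n) * real n powr (-1) * real N powr (1 - Re s)" for n
  proof (cases "n < N")
    case False
    have "real n powr (- Re s) = real n powr (-1) * real n powr (1 - Re s)"
      by (subst powr_add[symmetric]) simp
    also have "\<dots> \<le> real n powr (-1) * real N powr (1 - Re s)"
      using False s assms(2) by (intro mult_left_mono powr_mono2') auto
    finally show ?thesis
      unfolding norm_mult norm_of_nat_powr mult.assoc by (intro mult_left_mono) auto
  qed (use assms(3) in simp)
  have "cmod (dir_eval a s) \<le> (\<Sum>n. cmod (a n * of_nat n powr (- s)))"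
    unfolding dir_eval_def using s by (intro summable_norm dir_eval_abs_summable assms) auto
  also have "\<dots> \<le> (\<Sum>n. cmod (a n) * real n powr (-1) * real N powr (1 - Re s))"
    using s by (intro suminf_le le dir_eval_abs_summable assms summable_mult2 sum1) auto
  also have "\<dots> = (\<Sum>n. cmod (a n) * real n powr (-1)) * real N powr (1 - Re s)"
    by (rule suminf_mult2[symmetric, OF sum1])
  also have "real N powr (1 - Re s) = real N * real N powr (- Re s)"
    using assms(2) by (simp add: powr_diff powr_minus_divide)
  finally show "cmod (dir_eval a s)
      \<le> ((\<Sum>n. cmod (a n) * real n powr (-1)) * real N) * real N powr (- Re s)"
    by (simp add: mult.assoc)
qed

text \<open>The bound is uniform over complex s because it is later evaluated at s = \<phi>(x) as
  well as on the real axis.\<close>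

lemma dir_eval_expansion_bound:
  assumes "a \<in> Hdir" "N > 0"
  shows "\<exists>K. \<forall>s. Re s \<ge> 1 \<longrightarrow>
    cmod (dir_eval a s - (\<Sum>n\<in>{1..<N}. a n * of_nat n powr (- s))) \<le> K * real N powr (- Re s)"
proof -
  define t where "t = (\<lambda>n. if n < N then 0 else a n)"
  define h where "h = (\<lambda>n. if n < N then a n else 0)"
  have t: "t \<in> Hdir" and h: "h \<in> Hdir"
    unfolding t_def h_def by (auto intro: Hdir_bounded_by[OF assms(1)])
  have eq: "dir_eval a s - (\<Sum>n\<in>{1..<N}. a n * of_nat n powr (- s)) = dir_eval t s"
    if "Re s \<ge> 1" for s
  proof -
    have "(\<lambda>n. h n * of_nat n powr (- s)) sums (\<Sum>n\<in>{1..<N}. h n * of_nat n powr (- s))"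
      by (rule sums_finite) (auto simp: h_def Hdir_0[OF assms(1)] not_le)
    then have "dir_eval h s = (\<Sum>n\<in>{1..<N}. a n * of_nat n powr (- s))"
      by (simp add: dir_eval_def sums_iff h_def)
    moreover have "dir_eval a s = dir_eval h s + dir_eval t s"
      using dir_eval_add[OF h t, of s] that by (simp add: t_def h_def if_distrib cong: if_cong)
    ultimately show ?thesis by simp
  qed
  have "\<exists>K. \<forall>s. Re s \<ge> 1 \<longrightarrow> cmod (dir_eval t s) \<le> K * real N powr (- Re s)"
    by (rule dir_eval_tail_bound[OF t assms(2)]) (simp add: t_def)
  then show ?thesis
    using eq by simp
qed

section \<open>Asymptotic expansions along the real axis\<close>

definition dir_pow :: "nat \<Rightarrow> real \<Rightarrow> complex" where
  "dir_pow n x = of_nat n powr (- of_real x)"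

lemma norm_dir_pow: "cmod (dir_pow n x) = real n powr (- x)"
  by (simp add: dir_pow_def norm_of_nat_powr)

lemma dir_pow_nonzero: "n > 0 \<Longrightarrow> dir_pow n x \<noteq> 0"
  by (simp add: dir_pow_def)

lemma dir_pow_bigo: "0 < m \<Longrightarrow> m \<le> n \<Longrightarrow> dir_pow n \<in> O(dir_pow m)"
  by (rule bigoI[where c=1], rule eventually_mono[OF eventually_ge_at_top[of 0]])
    (auto simp: norm_dir_pow intro!: powr_mono2')

lemma dir_pow_quotient_tendsto_0:
  assumes "0 < m" "m < n"
  shows "((\<lambda>x. real n powr (- x) / real m powr (- x)) \<longlongrightarrow> 0) at_top"
proof -
  have "((\<lambda>x. (real m / real n) powr x) \<longlongrightarrow> 0) at_top"
  proof -
    have "LIM x at_top. ln (real m / real n) * x :> at_bot"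
      using assms by (intro filterlim_tendsto_neg_mult_at_bot[OF tendsto_const] filterlim_ident)
        (auto simp: ln_less_zero)
    then show ?thesis
      using assms by (simp add: powr_def mult.commute filterlim_compose[OF exp_at_bot])
  qed
  then show ?thesis
    using assms by (simp add: powr_divide powr_minus_divide)
qed

lemma dir_eval_expansion:
  assumes "a \<in> Hdir" "N > 0"
  shows "(\<lambda>x. dir_eval a (of_real x) - (\<Sum>n\<in>{1..<N}. a n * dir_pow n x)) \<in> O(dir_pow N)"
proof -
  obtain K where K: "\<And>s. Re s \<ge> 1 \<Longrightarrow>
    cmod (dir_eval a s - (\<Sum>n\<in>{1..<N}. a n * of_nat n powr (- s))) \<le> K * real N powr (- Re s)"
    using dir_eval_expansion_bound[OF assms] by blast
  show ?thesis
    by (rule bigoI[where c=K], rule eventually_mono[OF eventually_ge_at_top[of 1]])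
      (use K[of "of_real _"] in \<open>simp add: dir_pow_def norm_of_nat_powr\<close>)
qed

text \<open>Once all earlier coefficients vanish, the term at m dominates: after division by m^(-x)
  everything else is O(((m+1)/m)^(-x)) and tends to 0.\<close>

lemma dir_poly_bigo_imp_0:
  assumes "(\<lambda>x. \<Sum>n\<in>{1..<N}. d n * dir_pow n x) \<in> O(dir_pow N)" "n \<in> {1..<N}"
  shows "d n = 0"
  using assms(2)
proof (induction n rule: less_induct)
  case (less m)
  have "(\<Sum>n\<in>{1..<N}. d n * dir_pow n x) = d m * dir_pow m x + (\<Sum>n\<in>{Suc m..<N}. d n * dir_pow n x)" for x
  proof -
    have "{1..<N} = {1..<m} \<union> ({m} \<union> {Suc m..<N})"
      using less.prems by auto
    moreover have "(\<Sum>n\<in>{1..<m}. d n * dir_pow n x) = 0"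
      using less by (intro sum.neutral) auto
    ultimately show ?thesis
      by (simp only:) (subst sum.union_disjoint; auto)
  qed
  moreover have "(\<lambda>x. \<Sum>n\<in>{Suc m..<N}. d n * dir_pow n x) \<in> O(dir_pow (Suc m))"
  proof (intro big_sum_in_bigo)
    fix n assume "n \<in> {Suc m..<N}"
    then show "(\<lambda>x. d n * dir_pow n x) \<in> O(dir_pow (Suc m))"
      by (cases "d n = 0") (auto intro!: dir_pow_bigo)
  qed
  moreover have "(\<lambda>x. \<Sum>n\<in>{1..<N}. d n * dir_pow n x) \<in> O(dir_pow (Suc m))"
    using assms(1) by (rule landau_o.big_trans) (use less.prems in \<open>auto intro: dir_pow_bigo\<close>)
  ultimately have "(\<lambda>x. (d m * dir_pow m x + (\<Sum>n\<in>{Suc m..<N}. d n * dir_pow n x))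
      - (\<Sum>n\<in>{Suc m..<N}. d n * dir_pow n x)) \<in> O(dir_pow (Suc m))"
    by (intro sum_in_bigo(2)) auto
  then have "(\<lambda>x. d m * dir_pow m x) \<in> O(dir_pow (Suc m))"
    by simp
  then obtain C where C: "eventually (\<lambda>x. norm (d m * dir_pow m x) \<le> C * norm (dir_pow (Suc m) x)) at_top"
    by (elim landau_o.bigE)
  have "((\<lambda>x. C * (real (Suc m) powr (- x) / real m powr (- x))) \<longlongrightarrow> C * 0) at_top"
    using less.prems by (intro tendsto_intros dir_pow_quotient_tendsto_0) auto
  moreover have "eventually (\<lambda>x. cmod (d m) \<le> C * (real (Suc m) powr (- x) / real m powr (- x))) at_top"
    using C by (rule eventually_mono) (use less.prems in \<open>auto simp: norm_mult norm_dir_pow field_simps\<close>)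
  ultimately have "cmod (d m) \<le> C * 0"
    by (intro tendsto_lowerbound) auto
  then show ?case by simp
qed

text \<open>Behaviour along the real axis alone determines the coefficients. Coefficients of a
  composition are found this way: exhibit an expansion and compare.\<close>

lemma dir_eval_coeffs_unique:
  assumes "a \<in> Hdir"
    and "(\<lambda>x. dir_eval a (of_real x) - (\<Sum>n\<in>{1..<N}. c n * dir_pow n x)) \<in> O(dir_pow N)"
    and "n \<in> {1..<N}"
  shows "a n = c n"
proof -
  have "(\<lambda>x. (dir_eval a (of_real x) - (\<Sum>n\<in>{1..<N}. c n * dir_pow n x))
      - (dir_eval a (of_real x) - (\<Sum>n\<in>{1..<N}. a n * dir_pow n x))) \<in> O(dir_pow N)"
    using assms by (intro sum_in_bigo(2)[OF assms(2) dir_eval_expansion]) auto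
  then have "(\<lambda>x. \<Sum>n\<in>{1..<N}. (a n - c n) * dir_pow n x) \<in> O(dir_pow N)"
    by (simp add: sum_subtractf ring_distribs)
  from dir_poly_bigo_imp_0[OF this assms(3)] show ?thesis by simp
qed

text \<open>Uniqueness pins down the sequence chosen in \<open>comp_op\<close> and is the source of
  its linearity.\<close>

lemma dir_eval_inj:
  assumes "a \<in> Hdir" "b \<in> Hdir" "\<And>s. s \<in> half_plane (1/2) \<Longrightarrow> dir_eval a s = dir_eval b s"
  shows "a = b"
proof
  fix n
  show "a n = b n"
  proof (cases "n = 0")
    case False
    have ev: "eventually (\<lambda>x. dir_eval b (of_real x) - (\<Sum>n\<in>{1..<Suc n}. b n * dir_pow n x)
       = dir_eval a (of_real x) - (\<Sum>n\<in>{1..<Suc n}. b n * dir_pow n x)) at_top"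
      by (rule eventually_mono[OF eventually_gt_at_top[of "1/2"]])
        (simp add: assms(3) half_plane_def)
    have "(\<lambda>x. dir_eval a (of_real x) - (\<Sum>n\<in>{1..<Suc n}. b n * dir_pow n x)) \<in> O(dir_pow (Suc n))"
      using dir_eval_expansion[OF assms(2), of "Suc n"]
      by (subst landau_o.big.in_cong[OF ev, symmetric]) blast
    from dir_eval_coeffs_unique[OF assms(1) this, of n] show ?thesis
      using False by simp
  qed (simp add: Hdir_0[OF assms(1)] Hdir_0[OF assms(2)])
qed

section \<open>Composition operators\<close>

lemma
  assumes "comp_maps_H \<phi>" "a \<in> Hdir"
  shows comp_op_Hdir: "comp_op \<phi> a \<in> Hdir"
    and dir_eval_comp_op: "\<And>s. s \<in> half_plane (1/2) \<Longrightarrow> dir_eval (comp_op \<phi> a) s = dir_eval a (\<phi> s)"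
proof -
  have "\<exists>b. b \<in> Hdir \<and> (\<forall>s\<in>half_plane (1/2). dir_eval b s = dir_eval a (\<phi> s))"
    using assms unfolding comp_maps_H_def by blast
  from someI_ex[OF this] show "comp_op \<phi> a \<in> Hdir"
    and "\<And>s. s \<in> half_plane (1/2) \<Longrightarrow> dir_eval (comp_op \<phi> a) s = dir_eval a (\<phi> s)"
    unfolding comp_op_def by auto
qed

lemma comp_op_eqI:
  assumes "comp_maps_H \<phi>" "a \<in> Hdir" "b \<in> Hdir"
    and "\<And>s. s \<in> half_plane (1/2) \<Longrightarrow> dir_eval b s = dir_eval a (\<phi> s)"
  shows "comp_op \<phi> a = b"
  using assms by (intro dir_eval_inj) (auto simp: comp_op_Hdir dir_eval_comp_op)

text \<open>Linearity is not built into \<open>comp_op\<close>; it follows from uniqueness of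
  coefficients, since \<phi> takes values where the series converge and can be added.\<close>

lemma comp_op_linear:
  assumes "comp_maps_H \<phi>" "\<phi> ` half_plane (1/2) \<subseteq> half_plane (1/2)" "a \<in> Hdir" "b \<in> Hdir"
  shows "comp_op \<phi> (\<lambda>n. a n + c * b n) = (\<lambda>n. comp_op \<phi> a n + c * comp_op \<phi> b n)"
proof (rule comp_op_eqI)
  fix s assume s: "s \<in> half_plane (1/2)"
  then have "Re s > 1/2" "Re (\<phi> s) > 1/2"
    using assms(2) by (auto simp: half_plane_def)
  then show "dir_eval (\<lambda>n. comp_op \<phi> a n + c * comp_op \<phi> b n) s
      = dir_eval (\<lambda>n. a n + c * b n) (\<phi> s)"
    using assms s
    by (simp add: dir_eval_add dir_eval_scale Hdir_scale comp_op_Hdir dir_eval_comp_op)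
qed (use assms in \<open>auto intro!: Hdir_add Hdir_scale comp_op_Hdir\<close>)

lemma comp_op_funpow_Hdir:
  assumes "comp_maps_H \<phi>" "a \<in> Hdir"
  shows "(comp_op \<phi> ^^ k) a \<in> Hdir"
  by (induction k) (use assms in \<open>auto intro: comp_op_Hdir\<close>)

section \<open>Coefficients of recurrent vectors\<close>

lemma iter_conv_coeff:
  assumes "comp_maps_H \<phi>" "x \<in> Hdir" "iter_conv (comp_op \<phi>) \<omega> x"
  shows "(\<lambda>k. (comp_op \<phi> ^^ \<omega> k) x n) \<longlonglongrightarrow> x n"
proof (rule LIM_zero_cancel, rule Lim_null_comparison)
  show "\<forall>\<^sub>F k in sequentially. norm ((comp_op \<phi> ^^ \<omega> k) x n - x n)
      \<le> hnorm (\<lambda>n. (comp_op \<phi> ^^ \<omega> k) x n - x n)"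
    using assms by (intro always_eventually allI
      cmod_le_hnorm[of "\<lambda>n. (comp_op \<phi> ^^ \<omega> k) x n - x n" for k] Hdir_diff comp_op_funpow_Hdir)
  show "(\<lambda>k. hnorm (\<lambda>n. (comp_op \<phi> ^^ \<omega> k) x n - x n)) \<longlonglongrightarrow> 0"
    using assms(3) by (simp add: iter_conv_def)
qed

lemma hdense_coeff:
  assumes "hdense S" "a \<in> Hdir" "\<epsilon> > 0"
  shows "\<exists>x\<in>S. \<forall>n. cmod (x n - a n) < \<epsilon>"
proof -
  obtain x where x: "x \<in> S" "hnorm (\<lambda>n. x n - a n) < \<epsilon>"
    using assms unfolding hdense_def by blast
  moreover have "x \<in> Hdir"
    using assms(1) x(1) by (auto simp: hdense_def)
  ultimately show ?thesis
    using cmod_le_hnorm[OF Hdir_diff[OF _ assms(2)]] by (meson le_less_trans)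
qed

text \<open>The range of a recurrent operator is dense, so no nonzero functional vanishes on it.\<close>

lemma recurrent_functional_nonzero:
  assumes "comp_maps_H \<phi>" "recurrent (comp_op \<phi>)"
    and "\<And>a. a \<in> Hdir \<Longrightarrow> p * comp_op \<phi> a 2 + q * comp_op \<phi> a 3 = 0"
  shows "p = 0 \<and> q = 0"
proof -
  have rec0: "p * x 2 + q * x 3 = 0" if "x \<in> Rec (comp_op \<phi>)" for x
  proof -
    obtain \<omega> where x: "x \<in> Hdir" and \<omega>: "admissible_seq \<omega>" "iter_conv (comp_op \<phi>) \<omega> x"
      using \<open>x \<in> _\<close> by (auto simp: Rec_def)
    have "(\<lambda>k. p * (comp_op \<phi> ^^ \<omega> k) x 2 + q * (comp_op \<phi> ^^ \<omega> k) x 3) \<longlonglongrightarrow> p * x 2 + q * x 3"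
      using assms(1) x \<omega> by (intro tendsto_intros iter_conv_coeff)
    moreover have "p * (comp_op \<phi> ^^ \<omega> k) x 2 + q * (comp_op \<phi> ^^ \<omega> k) x 3 = 0" for k
    proof -
      \<comment> \<open>Since \<open>\<omega> k > 0\<close>, the iterate ends with an application of
        the operator and so lies in its range.\<close>
      obtain m where "\<omega> k = Suc m"
        using \<omega>(1) by (metis admissible_seq_def gr0_implies_Suc)
      then show ?thesis
        using assms(3)[OF comp_op_funpow_Hdir[OF assms(1) x, of m]] by simp
    qed
    ultimately show ?thesis
      by (simp add: LIMSEQ_const_iff)
  qed
  \<comment> \<open>The conjugate coefficients represent the functional, so its value at
    \<open>a\<close> is |p|^2 + |q|^2.\<close>
  define a where "a = (\<lambda>n::nat. if n = 2 then cnj p else if n = 3 then cnj q else 0)"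
  have a: "a \<in> Hdir"
    by (rule Hdir_finite_support[where N=4]) (auto simp: a_def)
  have "p * a 2 + q * a 3 = 0"
  proof (rule ccontr)
    assume nz: "p * a 2 + q * a 3 \<noteq> 0"
    \<comment> \<open>So small that the functional changes by less than its value at
      \<open>a\<close>; the summand 1 keeps the denominator positive.\<close>
    define \<epsilon> where "\<epsilon> = cmod (p * a 2 + q * a 3) / (cmod p + cmod q + 1)"
    have pos: "cmod p + cmod q + 1 > 0"
      by (smt (verit) norm_ge_zero)
    then have "\<epsilon> > 0"
      using nz by (simp add: \<epsilon>_def)
    then obtain x where x: "x \<in> Rec (comp_op \<phi>)" "\<And>n. cmod (x n - a n) < \<epsilon>"
      using hdense_coeff[OF _ a] assms(2) unfolding recurrent_def by blast
    have "p * (x 2 - a 2) + q * (x 3 - a 3) = (p * x 2 + q * x 3) - (p * a 2 + q * a 3)"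
      by (simp add: algebra_simps)
    then have "cmod (p * a 2 + q * a 3) = cmod (p * (x 2 - a 2) + q * (x 3 - a 3))"
      unfolding rec0[OF x(1)] by (simp only: diff_0 norm_minus_cancel)
    also have "\<dots> \<le> cmod p * cmod (x 2 - a 2) + cmod q * cmod (x 3 - a 3)"
      by (metis norm_mult norm_triangle_ineq)
    also have "\<dots> \<le> cmod p * \<epsilon> + cmod q * \<epsilon>"
      using x(2) by (intro add_mono mult_left_mono) (auto simp: less_imp_le)
    also have "\<dots> < (cmod p + cmod q + 1) * \<epsilon>"
      using \<open>\<epsilon> > 0\<close> by (simp add: algebra_simps)
    also have "\<dots> = cmod (p * a 2 + q * a 3)"
      using pos by (simp add: \<epsilon>_def)
    finally show False by simp
  qed
  then have "p * cnj p + q * cnj q = 0"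
    by (simp add: a_def)
  then have "complex_of_real ((cmod p)\<^sup>2 + (cmod q)\<^sup>2) = 0"
    by (simp only: of_real_add complex_norm_square)
  then have "(cmod p)\<^sup>2 + (cmod q)\<^sup>2 = 0"
    by (simp only: of_real_eq_0_iff)
  then show ?thesis
    by (simp add: sum_power2_eq_zero_iff)
qed

text \<open>Iteration multiplies the coefficient at 2 by powers of \<open>c\<close>. A recurrent
  vector close to 2^(-s) has a nonzero coefficient there, so \<open>c ^ \<omega> k\<close> tends to
  1, which excludes both decay and growth.\<close>

lemma recurrent_eigenvalue:
  assumes "comp_maps_H \<phi>" "recurrent (comp_op \<phi>)"
    and eig: "\<And>a. a \<in> Hdir \<Longrightarrow> comp_op \<phi> a 2 = c * a 2"
  shows "cmod c = 1"
proof -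
  obtain x where x: "x \<in> Rec (comp_op \<phi>)" "cmod (x 2 - dir_unit 2 2) < 1"
    using hdense_coeff[OF _ dir_unit_Hdir[of 2], where \<epsilon>=1] assms(2)
    unfolding recurrent_def by auto
  then have nz: "x 2 \<noteq> 0"
    by (auto simp: dir_unit_def)
  obtain \<omega> where xH: "x \<in> Hdir" and \<omega>: "admissible_seq \<omega>" "iter_conv (comp_op \<phi>) \<omega> x"
    using x by (auto simp: Rec_def)
  have "(comp_op \<phi> ^^ k) x 2 = c ^ k * x 2" for k
    by (induction k) (auto simp: eig comp_op_funpow_Hdir[OF assms(1) xH])
  then have "(\<lambda>k. c ^ \<omega> k * x 2) \<longlonglongrightarrow> x 2"
    using iter_conv_coeff[OF assms(1) xH \<omega>(2), of 2] by simp
  then have "(\<lambda>k. c ^ \<omega> k * x 2 / x 2) \<longlonglongrightarrow> x 2 / x 2"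
    by (intro tendsto_divide tendsto_const nz)
  then have "(\<lambda>k. cmod (c ^ \<omega> k)) \<longlonglongrightarrow> cmod 1"
    using nz by (intro tendsto_norm) simp
  then have lim: "(\<lambda>k. cmod c ^ \<omega> k) \<longlonglongrightarrow> 1"
    by (simp add: norm_power)
  have \<omega>_top: "filterlim \<omega> at_top sequentially"
    using \<omega>(1) by (simp add: admissible_seq_def filterlim_subseq)
  consider "cmod c < 1" | "cmod c > 1" | "cmod c = 1"
    by linarith
  then show ?thesis
  proof cases
    case 1
    then have "(\<lambda>k. cmod c ^ k) \<longlonglongrightarrow> 0"
      by (intro LIMSEQ_realpow_zero) auto
    from filterlim_compose[OF this \<omega>_top] lim show ?thesis
      using LIMSEQ_unique by fastforce
  next
    case 2
    have "1 < cmod c" by fact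
    moreover have "cmod c \<le> cmod c ^ \<omega> k" for k
      using 2 \<omega>(1) by (intro self_le_power) (auto simp: admissible_seq_def)
    then have "cmod c \<le> 1"
      by (intro LIMSEQ_le_const[OF lim]) auto
    ultimately show ?thesis by simp
  qed
qed

lemma comp_op_unit_eval:
  assumes "comp_maps_H \<phi>" "n > 0" "s \<in> half_plane (1/2)"
  shows "dir_eval (comp_op \<phi> (dir_unit n)) s = of_nat n powr (- \<phi> s)"
  using assms by (simp add: dir_eval_comp_op dir_unit_Hdir dir_eval_unit)

text \<open>If the leading exponent of \<open>2 powr -\<phi>\<close> is at least \<open>2\<close>, then \<open>Re (\<phi> x) \<ge> x - O(1)\<close>, so that all
  frequencies beyond \<open>2\<close> stay beyond \<open>2\<close>.\<close>

lemma comp_op_coeff_2: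
  assumes H: "comp_maps_H \<phi>" and b1: "comp_op \<phi> (dir_unit 2) 1 = 0" and a: "a \<in> Hdir"
  shows "comp_op \<phi> a 2 = comp_op \<phi> (dir_unit 2) 2 * a 2"
proof -
  define b where "b = comp_op \<phi> (dir_unit 2)"
  have b: "b \<in> Hdir"
    unfolding b_def using H by (intro comp_op_Hdir dir_unit_Hdir) auto
  have bev: "dir_eval b (of_real x) = 2 powr (- \<phi> (of_real x))" if "x > 1/2" for x
    using comp_op_unit_eval[OF H, of 2 "of_real x"] that by (simp add: b_def half_plane_def)
  have set2: "{1..<2} = {1::nat}" by auto
  have "(\<lambda>x. dir_eval b (of_real x) - (\<Sum>n\<in>{1..<2}. b n * dir_pow n x)) \<in> O(dir_pow 2)"
    by (rule dir_eval_expansion[OF b]) simp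
  then have "(\<lambda>x. dir_eval b (of_real x)) \<in> O(dir_pow 2)"
    using b1 unfolding set2 by (simp add: b_def)
  then obtain C where C: "C > 0" "eventually (\<lambda>x. cmod (dir_eval b (of_real x)) \<le> C * cmod (dir_pow 2 x)) at_top"
    by (elim landau_o.bigE)
  have ev2: "eventually (\<lambda>x. 2 powr (- Re (\<phi> (of_real x))) \<le> C * 2 powr (- x)) at_top"
    using C(2) eventually_gt_at_top[of "1/2"]
  proof eventually_elim
    case (elim x)
    then show ?case
      using bev[of x] norm_of_nat_powr[of 2 "- \<phi> (of_real x)"] by (simp add: norm_dir_pow)
  qed
  have Re_ge: "eventually (\<lambda>x. Re (\<phi> (of_real x)) \<ge> x - log 2 C) at_top"
    using ev2
  proof eventually_elim
    case (elim x)
    have "2 powr (- Re (\<phi> (of_real x))) \<le> 2 powr (log 2 C - x)"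
      using elim C(1) by (simp add: powr_diff powr_minus_divide)
    then show ?case by simp
  qed
  have Re_ge1: "eventually (\<lambda>x. Re (\<phi> (of_real x)) \<ge> 1) at_top"
    using Re_ge eventually_ge_at_top[of "1 + log 2 C"] by eventually_elim simp
  \<comment> \<open>Cutting at 3 separates a_1 + a_2 2^(-\<phi>); the rest is O(3^(-Re \<phi>)),
    hence O(3^(-x)).\<close>
  obtain K where K: "\<And>s. Re s \<ge> 1 \<Longrightarrow>
      cmod (dir_eval a s - (\<Sum>n\<in>{1..<3}. a n * of_nat n powr (- s))) \<le> K * real 3 powr (- Re s)"
    using dir_eval_expansion_bound[OF a, of 3] by auto
  have set3: "{1..<3} = {1,2::nat}" by auto
  have rem: "(\<lambda>x. dir_eval (comp_op \<phi> a) (of_real x) - (a 1 + a 2 * dir_eval b (of_real x))) \<in> O(dir_pow 3)"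
  proof (rule bigoI)
    show "eventually (\<lambda>x. norm (dir_eval (comp_op \<phi> a) (of_real x) - (a 1 + a 2 * dir_eval b (of_real x)))
       \<le> (\<bar>K\<bar> * 3 powr (log 2 C)) * norm (dir_pow 3 x)) at_top"
      using Re_ge1 Re_ge eventually_gt_at_top[of "1/2"]
    proof eventually_elim
      case (elim x)
      have "dir_eval (comp_op \<phi> a) (of_real x) - (a 1 + a 2 * dir_eval b (of_real x))
        = dir_eval a (\<phi> (of_real x)) - (\<Sum>n\<in>{1..<3}. a n * of_nat n powr (- \<phi> (of_real x)))"
        unfolding set3 using elim a by (simp add: dir_eval_comp_op[OF H] bev half_plane_def)
      then have "norm (dir_eval (comp_op \<phi> a) (of_real x) - (a 1 + a 2 * dir_eval b (of_real x)))
          \<le> K * 3 powr (- Re (\<phi> (of_real x)))"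
        using K[of "\<phi> (of_real x)"] elim by simp
      also have "\<dots> \<le> \<bar>K\<bar> * 3 powr (log 2 C - x)"
        using elim by (intro mult_mono powr_mono) auto
      finally show ?case
        by (simp add: norm_dir_pow powr_diff powr_minus_divide)
    qed
  qed
  \<comment> \<open>Since b_1 = 0, only b_2 2^(-x) survives below order 3.\<close>
  have "(\<lambda>x. dir_eval b (of_real x) - (\<Sum>n\<in>{1..<3}. b n * dir_pow n x)) \<in> O(dir_pow 3)"
    by (rule dir_eval_expansion[OF b]) simp
  then have "(\<lambda>x. a 2 * (dir_eval b (of_real x) - b 2 * dir_pow 2 x)) \<in> O(dir_pow 3)"
    using b1 unfolding set3 by (cases "a 2 = 0") (simp_all add: b_def)
  from sum_in_bigo(1)[OF rem this]
  have "(\<lambda>x. dir_eval (comp_op \<phi> a) (of_real x)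
      - (\<Sum>n\<in>{1..<3}. (if n = 1 then a 1 else b 2 * a 2) * dir_pow n x)) \<in> O(dir_pow 3)"
    unfolding set3 by (simp add: algebra_simps dir_pow_def)
  from dir_eval_coeffs_unique[OF comp_op_Hdir[OF H a] this, of 2] show ?thesis
    by (simp add: b_def)
qed

section \<open>Symbols with a finite limit\<close>

text \<open>The quotient exp(G)/b is eventually near 1, where the principal logarithm is continuous.
  Subtracting this logarithm from G leaves a continuous function whose values are all logarithms of
  b; these form a discrete set, so the function is constant.\<close>

lemma exp_tendsto_imp_branch:
  fixes G :: "real \<Rightarrow> complex"
  assumes cont: "continuous_on {R<..} G" and lim: "((\<lambda>x. exp (G x)) \<longlongrightarrow> b) at_top" and b: "b \<noteq> 0"
  shows "\<exists>\<alpha>. exp \<alpha> = b \<and> eventually (\<lambda>x. G x = \<alpha> + Ln (exp (G x) / b)) at_top"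
proof -
  have "((\<lambda>x. exp (G x) / b) \<longlongrightarrow> b / b) at_top"
    by (intro tendsto_intros lim b)
  then have "eventually (\<lambda>x. dist (exp (G x) / b) 1 < 1) at_top"
    using b by (intro tendstoD) auto
  then obtain R0 where R0: "\<And>x. x \<ge> R0 \<Longrightarrow> dist (exp (G x) / b) 1 < 1"
    by (auto simp: eventually_at_top_linorder)
  define R1 where "R1 = max R0 (R + 1)"
  define D where "D = (\<lambda>x. G x - Ln (exp (G x) / b))"
  have u: "exp (G x) / b \<notin> \<real>\<^sub>\<le>\<^sub>0" if "x \<ge> R1" for x
  proof
    assume "exp (G x) / b \<in> \<real>\<^sub>\<le>\<^sub>0"
    then have "Re (exp (G x) / b) \<le> 0"
      by (auto simp: complex_nonpos_Reals_iff)
    moreover have "\<bar>Re (exp (G x) / b - 1)\<bar> < 1"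
      using R0[of x] that abs_Re_le_cmod[of "exp (G x) / b - 1"] by (simp add: R1_def dist_norm)
    ultimately show False by simp
  qed
  have contG: "continuous_on {R1..} G"
    by (rule continuous_on_subset[OF cont]) (auto simp: R1_def)
  have contD: "continuous_on {R1..} D"
    unfolding D_def using u b by (intro continuous_intros contG) auto
  have expD: "exp (D x) = b" for x
    using b by (simp add: D_def exp_diff)
  have "D constant_on {R1..}"
  proof (rule continuous_discrete_range_constant[OF _ contD])
    fix x assume "x \<in> {R1..}"
    have "1 \<le> cmod (D y - D x)" if "D y \<noteq> D x" for y
    proof -
      obtain n :: int where n: "D y = D x + of_int (2 * n) * pi * \<i>"
        using expD[of x] expD[of y] exp_eq[of "D y" "D x"] by auto
      with that have "n \<noteq> 0" by auto
      then have "1 \<le> \<bar>of_int n :: real\<bar>" by linarith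
      also have "\<dots> \<le> \<bar>of_int n\<bar> * (2 * pi)"
        using pi_ge_two by (intro mult_right_le_one_le[THEN order_trans] mult_le_cancel_left1[THEN iffD2]) auto
      also have "\<dots> = cmod (D y - D x)"
        unfolding n by (simp add: norm_mult)
      finally show ?thesis .
    qed
    then show "\<exists>e>0. \<forall>y. y \<in> {R1..} \<and> D y \<noteq> D x \<longrightarrow> e \<le> norm (D y - D x)"
      by (intro exI[of _ 1]) auto
  qed auto
  then obtain \<alpha> where \<alpha>: "\<And>x. x \<ge> R1 \<Longrightarrow> D x = \<alpha>"
    by (auto simp: constant_on_def)
  have "exp \<alpha> = b"
    using expD[of R1] \<alpha>[of R1] by simp
  moreover have "G x = \<alpha> + Ln (exp (G x) / b)" if "x \<ge> R1" for x
    using \<alpha>[OF that] by (simp add: D_def diff_eq_eq)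
  then have "eventually (\<lambda>x. G x = \<alpha> + Ln (exp (G x) / b)) at_top"
    using eventually_ge_at_top[of R1] by (rule eventually_mono[rotated])
  ultimately show ?thesis by blast
qed

lemma exp_linear_bigo:
  fixes y :: "real \<Rightarrow> complex"
  assumes "(y \<longlongrightarrow> 0) at_top"
  shows "(\<lambda>x. exp (y x) - 1 - y x) \<in> O(\<lambda>x. y x ^ 2)"
proof (rule bigoI)
  have "eventually (\<lambda>x. dist (y x) 0 < 1) at_top"
    using assms by (rule tendstoD) simp
  then show "eventually (\<lambda>x. norm (exp (y x) - 1 - y x) \<le> exp 1 * norm (y x ^ 2)) at_top"
  proof eventually_elim
    case (elim x)
    have "norm (exp (y x) - 1 - y x) \<le> exp \<bar>Re (y x)\<bar> * norm (y x) ^ 2"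
      using Taylor_exp[of "y x" 1] by (simp add: diff_diff_eq power2_eq_square)
    also have "\<dots> \<le> exp 1 * norm (y x) ^ 2"
      using elim abs_Re_le_cmod[of "y x"] by (intro mult_right_mono) auto
    finally show ?case by (simp add: norm_power)
  qed
qed

lemma Ln_linear_bigo:
  fixes u :: "real \<Rightarrow> complex"
  assumes "(u \<longlongrightarrow> 0) at_top"
  shows "(\<lambda>x. Ln (1 + u x) - u x) \<in> O(\<lambda>x. u x ^ 2)"
proof (rule bigoI)
  have "eventually (\<lambda>x. dist (u x) 0 < 1/2) at_top"
    using assms by (rule tendstoD) simp
  then show "eventually (\<lambda>x. norm (Ln (1 + u x) - u x) \<le> 2 * norm (u x ^ 2)) at_top"
  proof eventually_elim
    case (elim x)
    have "norm (Ln (1 + u x) - u x) \<le> norm (u x) ^ 2 / (1 - norm (u x))"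
      using elim by (intro Ln_approx_linear) auto
    also have "\<dots> \<le> norm (u x) ^ 2 / (1/2)"
      using elim by (intro divide_left_mono) auto
    finally show ?case by (simp add: norm_power)
  qed
qed

text \<open>This is the binomial expansion of (1 + u)^\<kappa> on the principal branch; the errors
  of \<open>exp\<close> and of \<open>Ln\<close> are both quadratic in u.\<close>

lemma exp_Ln_linear_bigo:
  fixes u :: "real \<Rightarrow> complex"
  assumes "(u \<longlongrightarrow> 0) at_top"
  shows "(\<lambda>x. exp (\<kappa> * Ln (1 + u x)) - 1 - \<kappa> * u x) \<in> O(\<lambda>x. u x ^ 2)"
proof (cases "\<kappa> = 0")
  case False
  define L where "L = (\<lambda>x. Ln (1 + u x))"
  have L1: "(\<lambda>x. L x - u x) \<in> O(\<lambda>x. u x ^ 2)"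
    unfolding L_def by (rule Ln_linear_bigo[OF assms])
  have "(\<lambda>x. u x ^ 2) \<in> O(u)"
  proof -
    have "u \<in> O(\<lambda>_. 1)"
      using assms by (intro bigoI_tendsto[where c=0]) auto
    from landau_o.big.mult[OF this landau_o.big_refl[of u]] show ?thesis
      by (simp add: power2_eq_square)
  qed
  then have "(\<lambda>x. L x - u x) \<in> O(u)"
    by (rule landau_o.big_trans[OF L1])
  from sum_in_bigo(1)[OF this landau_o.big_refl[of u]] have L2: "L \<in> O(u)"
    by simp
  have "(L \<longlongrightarrow> Ln (1 + 0)) at_top"
    unfolding L_def by (intro tendsto_intros assms) auto
  then have "((\<lambda>x. \<kappa> * L x) \<longlongrightarrow> \<kappa> * 0) at_top"
    by (intro tendsto_intros) auto
  then have "(\<lambda>x. exp (\<kappa> * L x) - 1 - \<kappa> * L x) \<in> O(\<lambda>x. (\<kappa> * L x) ^ 2)"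
    by (intro exp_linear_bigo) auto
  also have "(\<lambda>x. (\<kappa> * L x) ^ 2) \<in> O(\<lambda>x. u x ^ 2)"
    using L2 False by (intro landau_o.big_power) auto
  finally have "(\<lambda>x. exp (\<kappa> * L x) - 1 - \<kappa> * L x) \<in> O(\<lambda>x. u x ^ 2)" .
  moreover have "(\<lambda>x. \<kappa> * (L x - u x)) \<in> O(\<lambda>x. u x ^ 2)"
    using L1 False by simp
  ultimately have "(\<lambda>x. exp (\<kappa> * L x) - 1 - \<kappa> * L x + \<kappa> * (L x - u x)) \<in> O(\<lambda>x. u x ^ 2)"
    by (rule sum_in_bigo(1))
  then show ?thesis
    by (simp add: L_def algebra_simps)
qed simp

text \<open>Quadratic errors in 2^(-x) have order 4^(-x), which is smaller than 3^(-x); hence a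
  first-order expansion still sees both frequencies 2 and 3.\<close>

lemma dir_pow_power2: "dir_pow 2 x ^ 2 = dir_pow 4 x"
proof -
  have "ln (4::real) = 2 * ln 2"
    using ln_realpow[of 2 2] by simp
  then have "Ln (4::complex) = 2 * Ln 2"
    using Ln_of_real[of 4] Ln_of_real[of 2] by simp
  then show ?thesis
    by (simp add: dir_pow_def powr_def power2_eq_square mult.left_commute flip: exp_add)
qed

lemma dir_pow_tendsto_0:
  assumes "n > 1" shows "(dir_pow n \<longlongrightarrow> 0) at_top"
proof (rule tendsto_norm_zero_cancel)
  show "((\<lambda>x. cmod (dir_pow n x)) \<longlongrightarrow> 0) at_top"
    using dir_pow_quotient_tendsto_0[of 1 n] assms by (simp add: norm_dir_pow)
qed

text \<open>If \<open>2 powr -\<phi>\<close> has a constant term, then \<open>\<phi>\<close> tends to a finite point \<open>\<alpha>\<close>, and to first order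
  \<open>f \<circ> \<phi>\<close> sees only \<open>f \<alpha>\<close> and \<open>f' \<alpha>\<close>: the coefficients at the two primes \<open>2\<close> and \<open>3\<close> become
  proportional.\<close>

lemma comp_op_unit_coeffs_proportional:
  assumes hol: "\<phi> holomorphic_on half_plane (1/2)" and H: "comp_maps_H \<phi>"
    and b_def: "b = comp_op \<phi> (dir_unit 2)" and b1: "b 1 \<noteq> 0" and n: "n > 0"
  shows "\<exists>\<mu>. comp_op \<phi> (dir_unit n) 2 = \<mu> * b 2 \<and> comp_op \<phi> (dir_unit n) 3 = \<mu> * b 3"
proof -
  have b: "b \<in> Hdir"
    unfolding b_def using H by (intro comp_op_Hdir dir_unit_Hdir) auto
  have set4: "{1..<4} = {1,2,3::nat}" by auto
  define \<Phi> where "\<Phi> = (\<lambda>x::real. \<phi> (of_real x))"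
  have cont\<Phi>: "continuous_on {1/2<..} \<Phi>"
    unfolding \<Phi>_def
    by (rule continuous_on_compose2[OF holomorphic_on_imp_continuous_on[OF hol]])
      (auto intro!: continuous_intros simp: half_plane_def)
  have ev: "dir_eval (comp_op \<phi> (dir_unit m)) (of_real x) = exp (- \<Phi> x * of_real (ln m))"
    if "x > 1/2" "m > 0" for x and m :: nat
    using comp_op_unit_eval[OF H, of m "of_real x"] that Ln_of_real[of "real m"]
    by (simp add: half_plane_def \<Phi>_def powr_def)
  define w where "w = (\<lambda>x. exp (- \<Phi> x * of_real (ln 2)))"
  have bw: "eventually (\<lambda>x. dir_eval b (of_real x) = w x) at_top"
    using eventually_gt_at_top[of "1/2"]
    by eventually_elim (use ev[of _ 2] in \<open>auto simp: b_def w_def\<close>)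
  have exp4: "(\<lambda>x. dir_eval b (of_real x) - (\<Sum>n\<in>{1..<4}. b n * dir_pow n x)) \<in> O(dir_pow 4)"
    by (rule dir_eval_expansion[OF b]) simp
  have ev4: "eventually (\<lambda>x. dir_eval b (of_real x) - (\<Sum>n\<in>{1..<4}. b n * dir_pow n x)
     = w x - b 1 - b 2 * dir_pow 2 x - b 3 * dir_pow 3 x) at_top"
    unfolding set4 using bw by eventually_elim (simp add: dir_pow_def[of 1] dir_pow_def[of "Suc 0"] algebra_simps)
  have w4: "(\<lambda>x. w x - b 1 - b 2 * dir_pow 2 x - b 3 * dir_pow 3 x) \<in> O(dir_pow 4)"
    by (rule iffD1[OF landau_o.big.in_cong[OF ev4] exp4])
  \<comment> \<open>The relative deviation of 2^(-\<phi>) from its limit \<open>b 1\<close>.\<close>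
  define u where "u = (\<lambda>x. (w x - b 1) / b 1)"
  have u1: "1 + u x = w x / b 1" for x
    using b1 by (simp add: u_def field_simps)
  have w2: "(\<lambda>x. w x - b 1) \<in> O(dir_pow 2)"
  proof -
    have 3: "(\<lambda>x. b 3 * dir_pow 3 x) \<in> O(dir_pow 2)"
      by (cases "b 3 = 0") (auto intro: dir_pow_bigo)
    have 2: "(\<lambda>x. b 2 * dir_pow 2 x) \<in> O(dir_pow 2)"
      by (cases "b 2 = 0") auto
    have "(\<lambda>x. w x - b 1 - b 2 * dir_pow 2 x - b 3 * dir_pow 3 x) \<in> O(dir_pow 2)"
      by (rule landau_o.big_trans[OF w4]) (auto intro: dir_pow_bigo)
    from sum_in_bigo(1)[OF sum_in_bigo(1)[OF this 3] 2] show ?thesis by simp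
  qed
  then have uO: "u \<in> O(dir_pow 2)"
    using b1 by (simp add: u_def)
  have u_lim: "(u \<longlongrightarrow> 0) at_top"
  proof -
    have "u \<in> o(\<lambda>_. 1)"
      by (rule landau_o.big_small_trans[OF uO]) (auto intro!: smalloI_tendsto dir_pow_tendsto_0)
    then show ?thesis
      using smalloD_tendsto by fastforce
  qed
  have "(w \<longlongrightarrow> b 1) at_top"
  proof -
    have "((\<lambda>x. (1 + u x) * b 1) \<longlongrightarrow> (1 + 0) * b 1) at_top"
      by (intro tendsto_intros u_lim)
    then show ?thesis using b1 by (simp add: u1)
  qed
  moreover have "continuous_on {1/2<..} (\<lambda>x. - \<Phi> x * of_real (ln 2))"
    by (intro continuous_intros cont\<Phi>)
  ultimately obtain \<alpha> where \<alpha>: "eventually (\<lambda>x. - \<Phi> x * of_real (ln 2) = \<alpha> + Ln (w x / b 1)) at_top"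
    using exp_tendsto_imp_branch[of "1/2" "\<lambda>x. - \<Phi> x * of_real (ln 2)" "b 1"] b1
    unfolding w_def by blast
  \<comment> \<open>The base 2 logarithm of n, so that n^(-\<phi>) is the \<kappa>-th power of
    2^(-\<phi>) on the chosen branch.\<close>
  define \<kappa> :: complex where "\<kappa> = of_real (ln n / ln 2)"
  define g where "g = comp_op \<phi> (dir_unit n)"
  have g: "g \<in> Hdir"
    unfolding g_def using H n by (intro comp_op_Hdir dir_unit_Hdir) auto
  \<comment> \<open>The factor that turns the linear term e^(\<kappa>\<alpha>) \<kappa> u into a
    multiple of w - b_1.\<close>
  define \<mu> where "\<mu> = exp (\<kappa> * \<alpha>) * \<kappa> / b 1"
  have gev: "eventually (\<lambda>x. dir_eval g (of_real x) = exp (\<kappa> * \<alpha>) * exp (\<kappa> * Ln (1 + u x))) at_top"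
    using \<alpha> eventually_gt_at_top[of "1/2"]
  proof eventually_elim
    case (elim x)
    have "dir_eval g (of_real x) = exp (\<kappa> * (- \<Phi> x * of_real (ln 2)))"
      using ev[OF elim(2) n] by (simp add: g_def \<kappa>_def mult.commute)
    also have "\<dots> = exp (\<kappa> * \<alpha>) * exp (\<kappa> * Ln (1 + u x))"
      unfolding elim(1) u1 by (simp add: ring_distribs exp_add)
    finally show ?case .
  qed
  have "(\<lambda>x. u x ^ 2) \<in> O(dir_pow 4)"
    using landau_o.big_power[OF uO, of 2] by (simp add: dir_pow_power2)
  then have "(\<lambda>x. exp (\<kappa> * Ln (1 + u x)) - 1 - \<kappa> * u x) \<in> O(dir_pow 4)"
    by (rule landau_o.big_trans[OF exp_Ln_linear_bigo[OF u_lim]])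
  then have 1: "(\<lambda>x. exp (\<kappa> * \<alpha>) * (exp (\<kappa> * Ln (1 + u x)) - 1 - \<kappa> * u x)) \<in> O(dir_pow 4)"
    by simp
  have 2: "(\<lambda>x. \<mu> * (w x - b 1 - b 2 * dir_pow 2 x - b 3 * dir_pow 3 x)) \<in> O(dir_pow 4)"
    using w4 by (cases "\<mu> = 0") auto
  \<comment> \<open>The expected coefficients of n^(-\<phi>) up to index 3: its limit, then the
    multiples of b_2 and b_3.\<close>
  define c where "c = (\<lambda>n::nat. if n = 1 then exp (\<kappa> * \<alpha>) else \<mu> * b n)"
  have ev3: "eventually (\<lambda>x. exp (\<kappa> * \<alpha>) * (exp (\<kappa> * Ln (1 + u x)) - 1 - \<kappa> * u x)
      + \<mu> * (w x - b 1 - b 2 * dir_pow 2 x - b 3 * dir_pow 3 x)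
      = dir_eval g (of_real x) - (\<Sum>n\<in>{1..<4}. c n * dir_pow n x)) at_top"
    using gev
  proof eventually_elim
    case (elim x)
    have "exp (\<kappa> * \<alpha>) * (\<kappa> * u x) = \<mu> * (w x - b 1)"
      using b1 by (simp add: \<mu>_def u_def)
    then show ?case
      unfolding elim set4 by (simp add: c_def dir_pow_def[of 1] dir_pow_def[of "Suc 0"] algebra_simps)
  qed
  have "(\<lambda>x. dir_eval g (of_real x) - (\<Sum>n\<in>{1..<4}. c n * dir_pow n x)) \<in> O(dir_pow 4)"
    by (rule iffD1[OF landau_o.big.in_cong[OF ev3] sum_in_bigo(1)[OF 1 2]])
  from dir_eval_coeffs_unique[OF g this, of 2] dir_eval_coeffs_unique[OF g this, of 3]
  have "g 2 = \<mu> * b 2" "g 3 = \<mu> * b 3"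
    by (auto simp: c_def)
  then show ?thesis
    unfolding g_def by blast
qed

section \<open>Linear functionals vanishing on the range\<close>

lemma hnorm_tail_tendsto_0:
  assumes "a \<in> Hdir"
  shows "(\<lambda>M. hnorm (\<lambda>n. a n - (if n < M then a n else 0))) \<longlonglongrightarrow> 0"
proof -
  have sm: "summable (\<lambda>n. (cmod (a n))\<^sup>2)"
    by (rule summable_Hdir[OF assms])
  have eq: "hnorm (\<lambda>n. a n - (if n < M then a n else 0)) = sqrt (\<Sum>n. (cmod (a (n + M)))\<^sup>2)" for M
  proof -
    define f where "f = (\<lambda>n. (cmod (a n - (if n < M then a n else 0)))\<^sup>2)"
    have "summable f"
      by (rule summable_comparison_test'[OF sm, where N=0]) (auto simp: f_def)
    then have "suminf f = (\<Sum>n. f (n + M)) + (\<Sum>n<M. f n)"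
      by (rule suminf_split_initial_segment)
    also have "(\<Sum>n<M. f n) = 0"
      by (intro sum.neutral) (auto simp: f_def)
    finally show ?thesis
      by (simp add: hnorm_def f_def)
  qed
  have "(\<lambda>M. \<Sum>n. (cmod (a (n + M)))\<^sup>2) \<longlonglongrightarrow> 0"
    using suminf_exist_split2[OF sm] by simp
  then show ?thesis
    unfolding eq using tendsto_real_sqrt by fastforce
qed

text \<open>By linearity the functional vanishes on all truncations of \<open>a\<close>. The
  operator norm bound makes it continuous, and the truncations converge to \<open>a\<close>.\<close>

lemma comp_op_functional_eq_0:
  assumes bdd: "comp_op_bounded \<phi>" and maps: "\<phi> ` half_plane (1/2) \<subseteq> half_plane (1/2)"
    and unit: "\<And>n. n > 0 \<Longrightarrow> p * comp_op \<phi> (dir_unit n) 2 + q * comp_op \<phi> (dir_unit n) 3 = 0"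
    and a: "a \<in> Hdir"
  shows "p * comp_op \<phi> a 2 + q * comp_op \<phi> a 3 = 0"
proof -
  have H: "comp_maps_H \<phi>"
    using bdd by (simp add: comp_op_bounded_def)
  obtain C where C: "\<And>a. a \<in> Hdir \<Longrightarrow> hnorm (comp_op \<phi> a) \<le> C * hnorm a"
    using bdd by (auto simp: comp_op_bounded_def)
  define \<Lambda> where "\<Lambda> = (\<lambda>a. p * comp_op \<phi> a 2 + q * comp_op \<phi> a 3)"
  define cut where "cut = (\<lambda>M n. if n < M then a n else 0)"
  have lin: "\<Lambda> (\<lambda>n. x n + c * y n) = \<Lambda> x + c * \<Lambda> y" if "x \<in> Hdir" "y \<in> Hdir" for x y c
    using comp_op_linear[OF H maps that] by (simp add: \<Lambda>_def algebra_simps)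
  have cutH: "cut M \<in> Hdir" for M
    unfolding cut_def by (auto intro: Hdir_bounded_by[OF a])
  have "\<Lambda> (cut M) = 0" for M
  proof (induction M)
    case 0
    \<comment> \<open>\<open>cut 0\<close> is the zero sequence, so it equals its own double and
      additivity forces the value 0.\<close>
    have "\<Lambda> (cut 0) = \<Lambda> (cut 0) + 1 * \<Lambda> (cut 0)"
      using lin[OF cutH[of 0] cutH[of 0], of 1] by (simp add: cut_def)
    then show ?case by simp
  next
    case (Suc M)
    show ?case
    proof (cases "M = 0")
      \<comment> \<open>The coefficient at index 0 vanishes, so no unit is added here.\<close>
      case True
      then have "cut (Suc M) = cut M"
        using Hdir_0[OF a] by (auto simp: cut_def)
      then show ?thesis using Suc by simp
    next
      case False
      have "cut (Suc M) = (\<lambda>n. cut M n + a M * dir_unit M n)"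
        by (auto simp: cut_def dir_unit_def less_Suc_eq)
      then have "\<Lambda> (cut (Suc M)) = \<Lambda> (cut M) + a M * \<Lambda> (dir_unit M)"
        using lin[OF cutH dir_unit_Hdir] False by simp
      then show ?thesis
        using Suc unit[of M] False by (simp add: \<Lambda>_def)
    qed
  qed
  then have \<Lambda>_eq: "\<Lambda> a = \<Lambda> (\<lambda>n. a n - cut M n)" for M
    using lin[OF a cutH[of M], of "-1"] by simp
  have bound: "cmod (\<Lambda> a) \<le> (cmod p + cmod q) * (C * hnorm (\<lambda>n. a n - cut M n))" for M
  proof -
    define r where "r = (\<lambda>n. a n - cut M n)"
    have r: "r \<in> Hdir"
      unfolding r_def by (intro Hdir_diff a cutH)
    have Tr: "cmod (comp_op \<phi> r n) \<le> C * hnorm r" for n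
      using cmod_le_hnorm[OF comp_op_Hdir[OF H r], of n] C[OF r] by linarith
    have "cmod (\<Lambda> r) \<le> cmod p * cmod (comp_op \<phi> r 2) + cmod q * cmod (comp_op \<phi> r 3)"
      unfolding \<Lambda>_def by (metis norm_mult norm_triangle_ineq)
    also have "\<dots> \<le> cmod p * (C * hnorm r) + cmod q * (C * hnorm r)"
      by (intro add_mono mult_left_mono Tr) auto
    finally show ?thesis
      unfolding \<Lambda>_eq[of M] r_def[symmetric] by (simp add: ring_distribs)
  qed
  have "(\<lambda>M. (cmod p + cmod q) * (C * hnorm (\<lambda>n. a n - cut M n))) \<longlonglongrightarrow> (cmod p + cmod q) * (C * 0)"
    unfolding cut_def by (intro tendsto_intros hnorm_tail_tendsto_0 a)
  then have "cmod (\<Lambda> a) \<le> (cmod p + cmod q) * (C * 0)"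
    by (rule LIMSEQ_le_const) (use bound in auto)
  then show ?thesis
    by (simp add: \<Lambda>_def)
qed

text \<open>By proportionality the functional b_3 x_2 - b_2 x_3 vanishes on the range. Density of
  the range forces b_2 = b_3 = 0, but then every vector in the range has coefficient 0 at 2,
  contradicting density again.\<close>

lemma recurrent_imp_leading_coeff_0:
  assumes hol: "\<phi> holomorphic_on half_plane (1/2)"
    and maps: "\<phi> ` half_plane (1/2) \<subseteq> half_plane (1/2)"
    and bdd: "comp_op_bounded \<phi>" and rec: "recurrent (comp_op \<phi>)"
  shows "comp_op \<phi> (dir_unit 2) 1 = 0"
proof (rule ccontr)
  define b where "b = comp_op \<phi> (dir_unit 2)"
  assume "comp_op \<phi> (dir_unit 2) 1 \<noteq> 0"
  then have b1: "b 1 \<noteq> 0" by (simp add: b_def)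
  have H: "comp_maps_H \<phi>"
    using bdd by (simp add: comp_op_bounded_def)
  have ratio: "\<exists>\<mu>. comp_op \<phi> (dir_unit n) 2 = \<mu> * b 2 \<and> comp_op \<phi> (dir_unit n) 3 = \<mu> * b 3" if "n > 0" for n
    using comp_op_unit_coeffs_proportional[OF hol H b_def b1 that] .
  have "b 3 * comp_op \<phi> (dir_unit n) 2 + (- b 2) * comp_op \<phi> (dir_unit n) 3 = 0" if "n > 0" for n
    using ratio[OF that] by auto
  from comp_op_functional_eq_0[OF bdd maps this] have "b 3 = 0 \<and> - b 2 = 0"
    by (intro recurrent_functional_nonzero[OF H rec])
  then have "1 * comp_op \<phi> (dir_unit n) 2 + 0 * comp_op \<phi> (dir_unit n) 3 = 0" if "n > 0" for n
    using ratio[OF that] by auto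
  from comp_op_functional_eq_0[OF bdd maps this] have "(1::complex) = 0 \<and> (0::complex) = 0"
    by (intro recurrent_functional_nonzero[OF H rec])
  then show False by simp
qed

section \<open>Boundary rigidity on the half-plane\<close>

text \<open>For positive real parts this puts the Cayley quotient (a - b)/(a + cnj b) inside the
  unit disc and measures how far inside it lies.\<close>

lemma cmod_diff_sq_cnj:
  "(cmod (a - b))\<^sup>2 = (cmod (a + cnj b))\<^sup>2 - 4 * Re a * Re b"
  unfolding cmod_power2 by (simp add: power2_eq_square algebra_simps)

text \<open>Cayley transforms carry \<open>x\<close> and its image under \<open>F\<close> to 0 and
  reduce the claim to the Schwarz lemma on the disc. The form without quotients suits the limits
  taken later.\<close>

lemma Schwarz_Pick_half_plane:
  assumes hol: "F holomorphic_on {s. Re s > 0}" and pos: "\<And>s. Re s > 0 \<Longrightarrow> Re (F s) > 0"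
    and s: "Re s > 0" and x: "(x::real) > 0"
  shows "Re s * x * (cmod (F s + cnj (F (of_real x))))\<^sup>2
    \<le> Re (F s) * Re (F (of_real x)) * (cmod (s + of_real x))\<^sup>2"
proof -
  define B where "B = F (of_real x)"
  \<comment> \<open>An inverse Cayley transform from the disc to the half-plane, with
    \<open>m 0 = x\<close>.\<close>
  define m where "m = (\<lambda>\<zeta>::complex. of_real x * (1 + \<zeta>) / (1 - \<zeta>))"
  define g where "g = (\<lambda>\<zeta>. (F (m \<zeta>) - B) / (F (m \<zeta>) + cnj B))"
  have B: "Re B > 0"
    unfolding B_def using pos x by simp
  have ne1: "1 - \<zeta> \<noteq> 0" if "cmod \<zeta> < 1" for \<zeta>
    using that by auto
  have Re_m: "Re (m \<zeta>) > 0" if "cmod \<zeta> < 1" for \<zeta>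
  proof -
    have "Re ((1 + \<zeta>) * cnj (1 - \<zeta>)) = 1 - (cmod \<zeta>)\<^sup>2"
      unfolding cmod_power2 by (simp add: power2_eq_square algebra_simps)
    then have "Re ((1 + \<zeta>) / (1 - \<zeta>)) = (1 - (cmod \<zeta>)\<^sup>2) / (cmod (1 - \<zeta>))\<^sup>2"
      by (simp only: complex_div_cnj[of "1 + \<zeta>"] Re_divide_of_real
          of_real_power[symmetric])
    moreover have "m \<zeta> = of_real x * ((1 + \<zeta>) / (1 - \<zeta>))"
      by (simp add: m_def)
    ultimately have "Re (m \<zeta>) = x * ((1 - (cmod \<zeta>)\<^sup>2) / (cmod (1 - \<zeta>))\<^sup>2)"
      by (metis Re_complex_of_real Im_complex_of_real mult_zero_left diff_zero times_complex.sel(1))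
    moreover have "(cmod \<zeta>)\<^sup>2 < 1"
      using that by (simp add: power_less_one_iff abs_square_less_1)
    ultimately show ?thesis
      using x ne1[OF that] by simp
  qed
  have denom: "F (m \<zeta>) + cnj B \<noteq> 0" if "cmod \<zeta> < 1" for \<zeta>
  proof -
    have "Re (F (m \<zeta>) + cnj B) > 0"
      using pos[OF Re_m[OF that]] B by simp
    then show ?thesis by force
  qed
  have holm: "m holomorphic_on ball 0 1"
    unfolding m_def by (intro holomorphic_intros) (use ne1 in auto)
  have holFm: "(\<lambda>\<zeta>. F (m \<zeta>)) holomorphic_on ball 0 1"
    using holomorphic_on_compose_gen[OF holm hol] Re_m by (force simp: o_def)
  have holg: "g holomorphic_on ball 0 1"
    unfolding g_def by (intro holomorphic_intros holFm) (use denom in auto)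
  have gless: "cmod (g \<zeta>) < 1" if "cmod \<zeta> < 1" for \<zeta>
  proof -
    have "(cmod (F (m \<zeta>) - B))\<^sup>2 < (cmod (F (m \<zeta>) + cnj B))\<^sup>2"
      unfolding cmod_diff_sq_cnj using pos[OF Re_m[OF that]] B by simp
    then have "cmod (F (m \<zeta>) - B) < cmod (F (m \<zeta>) + cnj B)"
      by (rule power2_less_imp_less) simp
    then show ?thesis
      using denom[OF that] by (simp add: g_def norm_divide)
  qed
  have g0: "g 0 = 0"
    by (simp add: g_def m_def B_def)
  define \<zeta> where "\<zeta> = (s - of_real x) / (s + of_real x)"
  have sx: "s + of_real x \<noteq> 0"
  proof -
    have "Re (s + of_real x) > 0" using s x by simp
    then show ?thesis by force
  qed
  have "(cmod (s - of_real x))\<^sup>2 < (cmod (s + of_real x))\<^sup>2"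
    using cmod_diff_sq_cnj[of s "of_real x"] s x by simp
  then have "cmod (s - of_real x) < cmod (s + of_real x)"
    by (rule power2_less_imp_less) simp
  then have \<zeta>: "cmod \<zeta> < 1"
    using sx by (simp add: \<zeta>_def norm_divide)
  have "1 + \<zeta> = 2 * s / (s + of_real x)" "1 - \<zeta> = 2 * of_real x / (s + of_real x)"
    using sx by (simp_all add: \<zeta>_def field_simps)
  then have m\<zeta>: "m \<zeta> = s"
    using sx x by (simp add: m_def)
  have "cmod (g \<zeta>) \<le> cmod \<zeta>"
    by (rule Schwarz_Lemma(1)[OF holg g0 gless \<zeta>])
  then have "cmod (F s - B) / cmod (F s + cnj B) \<le> cmod (s - of_real x) / cmod (s + of_real x)"
    unfolding g_def m\<zeta> by (simp add: norm_divide \<zeta>_def)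
  moreover have d: "cmod (F s + cnj B) > 0" "cmod (s + of_real x) > 0"
    using denom[OF \<zeta>] sx by (auto simp: m\<zeta>)
  ultimately have "cmod (F s - B) * cmod (s + of_real x) \<le> cmod (s - of_real x) * cmod (F s + cnj B)"
    by (simp add: field_simps)
  then have "(cmod (F s - B) * cmod (s + of_real x))\<^sup>2 \<le> (cmod (s - of_real x) * cmod (F s + cnj B))\<^sup>2"
    by (intro power_mono) auto
  \<comment> \<open>The product of the two squared moduli of sums occurs on both sides and cancels,
    leaving the claim times -4.\<close>
  then have "((cmod (F s + cnj B))\<^sup>2 - 4 * Re (F s) * Re B) * (cmod (s + of_real x))\<^sup>2
     \<le> ((cmod (s + of_real x))\<^sup>2 - 4 * Re s * x) * (cmod (F s + cnj B))\<^sup>2"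
    using cmod_diff_sq_cnj[of s "of_real x"] by (simp add: power_mult_distrib cmod_diff_sq_cnj)
  then show ?thesis
    unfolding B_def[symmetric] by (simp add: algebra_simps)
qed

text \<open>Julia's lemma with boundary fixed point \<open>\<infinity>\<close>: let the base point of the Schwarz--Pick inequality
  tend to \<open>\<infinity>\<close>.\<close>

lemma Julia_half_plane:
  assumes hol: "F holomorphic_on {s. Re s > 0}" and pos: "\<And>s. Re s > 0 \<Longrightarrow> Re (F s) > 0"
    and lim: "((\<lambda>x. F (of_real x) / of_real x) \<longlongrightarrow> 1) at_top" and s: "Re s > 0"
  shows "Re s \<le> Re (F s)"
proof (rule tendsto_le[OF trivial_limit_at_top_linorder])
  have inv0: "((\<lambda>x. c / complex_of_real x) \<longlongrightarrow> 0) at_top" for c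
    by (intro tendsto_divide_0[OF tendsto_const] filterlim_of_real_at_infinity) 
  have "((\<lambda>x. Re (F s) * Re (F (of_real x) / of_real x) * (cmod (s / of_real x + 1))\<^sup>2)
      \<longlongrightarrow> Re (F s) * Re 1 * (cmod (0 + 1))\<^sup>2) at_top"
    by (intro tendsto_intros inv0 lim)
  then show "((\<lambda>x. Re (F s) * Re (F (of_real x) / of_real x) * (cmod (s / of_real x + 1))\<^sup>2)
      \<longlongrightarrow> Re (F s)) at_top"
    by simp
  have "((\<lambda>x. Re s * (cmod (F s / of_real x + cnj (F (of_real x) / of_real x)))\<^sup>2)
      \<longlongrightarrow> Re s * (cmod (0 + cnj 1))\<^sup>2) at_top"
    by (intro tendsto_intros inv0 lim)
  then show "((\<lambda>x. Re s * (cmod (F s / of_real x + cnj (F (of_real x) / of_real x)))\<^sup>2)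
      \<longlongrightarrow> Re s) at_top"
    by simp
  show "eventually (\<lambda>x. Re s * (cmod (F s / of_real x + cnj (F (of_real x) / of_real x)))\<^sup>2
      \<le> Re (F s) * Re (F (of_real x) / of_real x) * (cmod (s / of_real x + 1))\<^sup>2) at_top"
    using eventually_gt_at_top[of 0]
  proof eventually_elim
    case (elim x)
    have 1: "F s / of_real x + cnj (F (of_real x) / of_real x) = (F s + cnj (F (of_real x))) / of_real x"
      by (simp add: add_divide_distrib)
    have 2: "s / of_real x + 1 = (s + of_real x) / of_real x"
      using elim by (simp add: add_divide_distrib)
    \<comment> \<open>Of the three factors x, one cancels on the left and divides F(x) on the right;
      the other two go under the squared moduli.\<close>
    have "(Re s * x * (cmod (F s + cnj (F (of_real x))))\<^sup>2) / x ^ 3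
        \<le> (Re (F s) * Re (F (of_real x)) * (cmod (s + of_real x))\<^sup>2) / x ^ 3"
      using elim by (intro divide_right_mono Schwarz_Pick_half_plane hol pos s) auto
    then show ?case
      unfolding 1 2 using elim
      by (simp add: norm_divide power_divide power2_eq_square power3_eq_cube Re_divide_of_real)
  qed
qed

text \<open>A boundary rigidity statement in the style of Burns and Krantz: \<open>F s - s\<close> has nonnegative real
  part by Julia's lemma, and a positive harmonic function cannot decay faster than \<open>1/x\<close>.\<close>

lemma half_plane_rigidity:
  assumes hol: "F holomorphic_on {s. Re s > 0}" and pos: "\<And>s. Re s > 0 \<Longrightarrow> Re (F s) > 0"
    and lim: "((\<lambda>x. F (of_real x) / of_real x) \<longlongrightarrow> 1) at_top"
    and decay: "((\<lambda>x. x * (Re (F (of_real x)) - x)) \<longlongrightarrow> 0) at_top"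
  shows "\<exists>t::real. \<forall>s. Re s > 0 \<longrightarrow> F s = s + \<i> * of_real t"
proof -
  define U where "U = {s. Re s > 0}"
  define G where "G = (\<lambda>s. F s - s)"
  have U: "open U" "connected U"
    unfolding U_def using convex_halfspace_Re_gt[of 0] by (auto simp: open_halfspace_Re_gt convex_connected)
  have holG: "G holomorphic_on U"
    unfolding G_def U_def by (intro holomorphic_intros hol)
  have nonneg: "Re (G s) \<ge> 0" if "s \<in> U" for s
    using Julia_half_plane[OF hol pos lim, of s] that by (simp add: U_def G_def)
  have decayG: "((\<lambda>x. x * Re (G (of_real x))) \<longlongrightarrow> 0) at_top"
    using decay by (simp add: G_def)
  have "G constant_on U"
  proof (rule ccontr)
    assume nc: "\<not> G constant_on U"
    have "open (G ` U)"
      by (rule open_mapping_thm[OF holG U U(1) subset_refl nc])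
    \<comment> \<open>If the real part vanished at some point, the open image would contain points
      of negative real part.\<close>
    have posG: "Re (G s) > 0" if "Re s > 0" for s
    proof (rule ccontr)
      assume "\<not> Re (G s) > 0"
      have "G s \<in> G ` U"
        using that by (simp add: U_def)
      with \<open>open (G ` U)\<close> obtain e where e: "e > 0" "ball (G s) e \<subseteq> G ` U"
        by (auto simp: open_contains_ball)
      then have "G s - of_real (e / 2) \<in> G ` U"
        by (intro subsetD[OF e(2)]) (auto simp: dist_norm)
      then have "Re (G s - of_real (e / 2)) \<ge> 0"
        using nonneg by (metis imageE)
      then show False
        using e(1) \<open>\<not> Re (G s) > 0\<close> by simp
    qed
    define A where "A = Re (G 1)"
    have A: "A > 0"
      using posG[of 1] by (simp add: A_def)
    \<comment> \<open>A Harnack bound: the Schwarz-Pick inequality for \<open>G\<close> with base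
      point 1 gives Re G(x) >= A x/(x+1)^2. Multiplied by x, the lower bound tends to A > 0, against
      the decay hypothesis.\<close>
    have "eventually (\<lambda>x. A * (x / (x + 1))\<^sup>2 \<le> x * Re (G (of_real x))) at_top"
      using eventually_gt_at_top[of 0]
    proof eventually_elim
      case (elim x)
      have "x * A\<^sup>2 \<le> x * (cmod (G (of_real x) + cnj (G 1)))\<^sup>2"
      proof -
        have "A \<le> Re (G (of_real x) + cnj (G 1))"
          using posG[of "of_real x"] elim by (simp add: A_def)
        also have "\<dots> \<le> cmod (G (of_real x) + cnj (G 1))"
          by (rule complex_Re_le_cmod)
        finally show ?thesis
          using A elim by (intro mult_left_mono power_mono) auto
      qed
      also have "\<dots> \<le> Re (G (of_real x)) * A * (cmod (of_real x + 1))\<^sup>2"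
        using Schwarz_Pick_half_plane[OF holG[unfolded U_def] posG, of "of_real x" 1] elim
        by (simp add: A_def)
      also have "cmod (of_real x + 1) = x + 1"
        using elim by (metis norm_of_real of_real_1 of_real_add abs_of_pos add_pos_pos zero_less_one)
      finally have "x * A \<le> Re (G (of_real x)) * (x + 1)\<^sup>2"
        using A by (simp add: power2_eq_square mult.assoc mult.left_commute)
      then have "x * (x * A) \<le> x * (Re (G (of_real x)) * (x + 1)\<^sup>2)"
        using elim by (intro mult_left_mono) auto
      then show ?case
        using elim by (simp add: power_divide pos_divide_le_eq power2_eq_square mult_ac)
    qed
    moreover have "((\<lambda>x::real. A * (x / (x + 1))\<^sup>2) \<longlongrightarrow> A * 1\<^sup>2) at_top"
    proof (intro tendsto_intros)
      have "((\<lambda>x::real. 1 - 1 / (x + 1)) \<longlongrightarrow> 1 - 0) at_top"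
        by (intro tendsto_intros tendsto_divide_0[OF tendsto_const] filterlim_at_top_imp_at_infinity
            filterlim_tendsto_add_at_top[OF tendsto_const filterlim_ident, of 1, simplified add.commute])
      moreover have "eventually (\<lambda>x::real. 1 - 1 / (x + 1) = x / (x + 1)) at_top"
        using eventually_gt_at_top[of 0] by eventually_elim (simp add: field_simps)
      ultimately show "((\<lambda>x::real. x / (x + 1)) \<longlongrightarrow> 1) at_top"
        by (auto elim: Lim_transform_eventually)
    qed
    ultimately have "A * 1\<^sup>2 \<le> 0"
      by (intro tendsto_le[OF trivial_limit_at_top_linorder decayG])
    with A show False by simp
  qed
  then obtain c where c: "\<And>s. s \<in> U \<Longrightarrow> G s = c"
    by (auto simp: constant_on_def)
  \<comment> \<open>The decay hypothesis also rules out a horizontal shift.\<close>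
  have "Re c = 0"
  proof -
    have "((\<lambda>x::real. inverse x) \<longlongrightarrow> 0) at_top"
      by (intro tendsto_inverse_0_at_top filterlim_ident)
    from tendsto_mult[OF this decayG]
    have "((\<lambda>x. inverse x * (x * Re (G (of_real x)))) \<longlongrightarrow> 0) at_top" by simp
    moreover have "eventually (\<lambda>x. inverse x * (x * Re (G (of_real x))) = Re c) at_top"
      using eventually_gt_at_top[of 0] by eventually_elim (simp add: c U_def)
    ultimately have "((\<lambda>x::real. Re c) \<longlongrightarrow> 0) at_top"
      by (rule Lim_transform_eventually)
    then show ?thesis
      by (simp add: tendsto_const_iff)
  qed
  then have "F s = s + \<i> * of_real (Im c)" if "Re s > 0" for s
    using c[of s] that by (simp add: G_def U_def complex_eq_iff)
  then show ?thesis by blast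
qed

section \<open>From a coefficient of modulus one to a translation\<close>

lemma real_times_dir_pow_quotient_tendsto_0:
  "((\<lambda>x. x * (3 powr (- x) / 2 powr (- x))) \<longlongrightarrow> (0::real)) at_top"
proof -
  define c :: real where "c = ln (3/2)"
  have c: "c > 0" by (simp add: c_def)
  have "((\<lambda>x. (1 / c) * ((c * x) ^ 1 / exp (c * x))) \<longlongrightarrow> (1 / c) * 0) at_top"
    using c by (intro tendsto_intros filterlim_compose[OF tendsto_power_div_exp_0]
        filterlim_tendsto_pos_mult_at_top[OF tendsto_const] filterlim_ident) auto
  moreover have "3 powr (- x) / 2 powr (- x) = inverse (exp (c * x))" for x :: real
    by (simp add: c_def ln_div powr_def algebra_simps exp_diff exp_minus field_simps)
  ultimately show ?thesis
    using c by (simp add: field_simps)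
qed

text \<open>Since 2^(-(\<phi>(x) - x)) = b_2 + O((2/3)^x), a continuous logarithm shows that
  \<phi>(x) - x tends exponentially fast to a constant, which is imaginary because |b_2| = 1. After
  the boundary line is moved to Re s = 0, both limit hypotheses of
  \<open>half_plane_rigidity\<close> hold.\<close>

lemma translation_of_unimodular_coeff:
  assumes hol: "\<phi> holomorphic_on half_plane (1/2)"
    and maps: "\<phi> ` half_plane (1/2) \<subseteq> half_plane (1/2)"
    and H: "comp_maps_H \<phi>"
    and b1: "comp_op \<phi> (dir_unit 2) 1 = 0" and b2: "cmod (comp_op \<phi> (dir_unit 2) 2) = 1"
  shows "\<exists>t::real. \<forall>s\<in>half_plane (1/2). \<phi> s = s + \<i> * of_real t"
proof -
  define b where "b = comp_op \<phi> (dir_unit 2)"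
  have b: "b \<in> Hdir"
    unfolding b_def using H by (intro comp_op_Hdir dir_unit_Hdir) auto
  have nz: "b 2 \<noteq> 0"
    using b2 by (auto simp: b_def)
  \<comment> \<open>A logarithm of 2^(-(\<phi>(x) - x)) that is continuous in x.\<close>
  define G where "G = (\<lambda>x::real. - (\<phi> (of_real x) - of_real x) * of_real (ln 2))"
  define r where "r = (\<lambda>x::real. 3 powr (- x) / 2 powr (- x))"
  have Ln2: "Ln (2::complex) = of_real (ln 2)"
    using Ln_of_real[of 2] by simp
  have expG: "exp (G x) = dir_eval b (of_real x) / dir_pow 2 x" if "x > 1/2" for x
  proof -
    have "dir_eval b (of_real x) = exp (- \<phi> (of_real x) * of_real (ln 2))"
      using comp_op_unit_eval[OF H, of 2 "of_real x"] that
      by (simp add: b_def half_plane_def powr_def Ln2)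
    moreover have "dir_pow 2 x = exp (- of_real x * of_real (ln 2))"
      by (simp add: dir_pow_def powr_def Ln2)
    ultimately show ?thesis
      by (simp add: G_def algebra_simps flip: exp_diff)
  qed
  have set3: "{1..<3} = {1,2::nat}" by auto
  have "(\<lambda>x. dir_eval b (of_real x) - (\<Sum>n\<in>{1..<3}. b n * dir_pow n x)) \<in> O(dir_pow 3)"
    by (rule dir_eval_expansion[OF b]) simp
  then have "(\<lambda>x. dir_eval b (of_real x) - b 2 * dir_pow 2 x) \<in> O(dir_pow 3)"
    using b1 unfolding set3 by (simp add: b_def)
  then obtain C where C: "C > 0"
    "eventually (\<lambda>x. cmod (dir_eval b (of_real x) - b 2 * dir_pow 2 x) \<le> C * cmod (dir_pow 3 x)) at_top"
    by (elim landau_o.bigE)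
  define v where "v = (\<lambda>x. exp (G x) / b 2 - 1)"
  have v_bound: "eventually (\<lambda>x. cmod (v x) \<le> C * r x) at_top"
    using C(2) eventually_gt_at_top[of "1/2"]
  proof eventually_elim
    case (elim x)
    have "v x = (dir_eval b (of_real x) - b 2 * dir_pow 2 x) / (dir_pow 2 x * b 2)"
      using nz dir_pow_nonzero[of 2 x] unfolding v_def expG[OF elim(2)]
      by (simp add: field_simps)
    then have "cmod (v x) = cmod (dir_eval b (of_real x) - b 2 * dir_pow 2 x) / 2 powr (- x)"
      using b2 by (simp add: norm_divide norm_mult norm_dir_pow b_def)
    also have "\<dots> \<le> C * cmod (dir_pow 3 x) / 2 powr (- x)"
      using elim(1) by (intro divide_right_mono) auto
    finally show ?case
      by (simp add: norm_dir_pow r_def)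
  qed
  have r_lim: "(r \<longlongrightarrow> 0) at_top"
    using dir_pow_quotient_tendsto_0[of 2 3] by (simp add: r_def)
  have v_lim: "(v \<longlongrightarrow> 0) at_top"
    by (rule Lim_null_comparison[OF v_bound]) (use tendsto_mult_left[OF r_lim, of C] in simp)
  have "((\<lambda>x. (v x + 1) * b 2) \<longlongrightarrow> (0 + 1) * b 2) at_top"
    by (intro tendsto_intros v_lim)
  then have "((\<lambda>x. exp (G x)) \<longlongrightarrow> b 2) at_top"
    using nz by (simp add: v_def)
  moreover have "continuous_on {1/2<..} G"
    unfolding G_def
    by (intro continuous_intros continuous_on_compose2[OF holomorphic_on_imp_continuous_on[OF hol]])
      (auto simp: half_plane_def)
  ultimately obtain \<alpha> where \<alpha>: "exp \<alpha> = b 2"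
      "eventually (\<lambda>x. G x = \<alpha> + Ln (exp (G x) / b 2)) at_top"
    using exp_tendsto_imp_branch[of "1/2" G "b 2"] nz by blast
  have Re\<alpha>: "Re \<alpha> = 0"
  proof -
    have "exp (Re \<alpha>) = 1"
      using b2 by (simp add: b_def flip: \<alpha>(1)[unfolded b_def] norm_exp_eq_Re)
    then show ?thesis by simp
  qed
  have v_small: "eventually (\<lambda>x. dist (v x) 0 < 1/2) at_top"
    using v_lim by (rule tendstoD) simp
  have G_bound: "eventually (\<lambda>x. cmod (G x - \<alpha>) \<le> 2 * C * r x) at_top"
    using \<alpha>(2) v_small v_bound
  proof eventually_elim
    case (elim x)
    have "G x - \<alpha> = Ln (1 + v x)"
      using elim(1) by (simp add: v_def algebra_simps)
    also have "cmod \<dots> \<le> 2 * cmod (v x)"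
      using elim(2) by (intro norm_Ln_le) simp
    finally show ?case
      using elim(3) by simp
  qed
  have shift: "filterlim (\<lambda>x::real. x + 1/2) at_top at_top"
    using filterlim_tendsto_add_at_top[OF tendsto_const filterlim_ident, of "1/2"]
    by (simp add: add.commute)
  define F where "F = (\<lambda>s. \<phi> (s + 1/2) - 1/2)"
  have FG: "F (of_real x) = of_real x - G (x + 1/2) / of_real (ln 2)" for x
    by (simp add: F_def G_def field_simps)
  have holF: "F holomorphic_on {s. Re s > 0}"
  proof -
    have "(\<phi> \<circ> (\<lambda>s. s + 1/2)) holomorphic_on {s. Re s > 0}"
      by (rule holomorphic_on_compose_gen[OF _ hol]) (auto intro!: holomorphic_intros simp: half_plane_def)
    then show ?thesis
      unfolding F_def o_def by (intro holomorphic_intros)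
  qed
  have posF: "Re (F s) > 0" if "Re s > 0" for s
  proof -
    have "s + 1/2 \<in> half_plane (1/2)"
      using that by (simp add: half_plane_def)
    then have "\<phi> (s + 1/2) \<in> half_plane (1/2)"
      using maps by blast
    then show ?thesis
      by (simp add: F_def half_plane_def)
  qed
  have limF: "((\<lambda>x. F (of_real x) / of_real x) \<longlongrightarrow> 1) at_top"
  proof -
    have "((\<lambda>x. G x - \<alpha>) \<longlongrightarrow> 0) at_top"
      by (rule Lim_null_comparison[OF G_bound]) (use tendsto_mult_left[OF r_lim, of "2 * C"] in simp)
    then have "(G \<longlongrightarrow> \<alpha>) at_top"
      by (rule LIM_zero_cancel)
    from filterlim_compose[OF this shift]
    have "((\<lambda>x. G (x + 1/2) / of_real (ln 2)) \<longlongrightarrow> \<alpha> / of_real (ln 2)) at_top"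
      by (intro tendsto_divide tendsto_const) auto
    then have "((\<lambda>x. 1 - G (x + 1/2) / of_real (ln 2) / of_real x) \<longlongrightarrow> 1 - 0) at_top"
      by (intro tendsto_diff tendsto_const tendsto_divide_0[OF _ filterlim_of_real_at_infinity])
    moreover have "eventually (\<lambda>x. 1 - G (x + 1/2) / of_real (ln 2) / of_real x
        = F (of_real x) / of_real x) at_top"
      using eventually_gt_at_top[of 0]
      by eventually_elim (simp add: FG diff_divide_distrib)
    ultimately show ?thesis
      by (auto elim: Lim_transform_eventually)
  qed
  have decayF: "((\<lambda>x. x * (Re (F (of_real x)) - x)) \<longlongrightarrow> 0) at_top"
  proof (rule Lim_null_comparison)
    have "((\<lambda>x. x * r x) \<longlongrightarrow> 0) at_top"
      using real_times_dir_pow_quotient_tendsto_0 by (simp add: r_def)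
    from tendsto_mult_left[OF filterlim_compose[OF this shift], of "2 * C / ln 2"]
    show "((\<lambda>x. 2 * C / ln 2 * ((x + 1/2) * r (x + 1/2))) \<longlongrightarrow> 0) at_top"
      by simp
    have "eventually (\<lambda>x. cmod (G (x + 1/2) - \<alpha>) \<le> 2 * C * r (x + 1/2)) at_top"
      using filterlim_iff[THEN iffD1, OF shift] G_bound by blast
    then show "eventually (\<lambda>x. norm (x * (Re (F (of_real x)) - x))
        \<le> 2 * C / ln 2 * ((x + 1/2) * r (x + 1/2))) at_top"
      using eventually_gt_at_top[of 0]
    proof eventually_elim
      case (elim x)
      have "\<bar>Re (G (x + 1/2))\<bar> \<le> 2 * C * r (x + 1/2)"
        using elim(1) abs_Re_le_cmod[of "G (x + 1/2) - \<alpha>"] Re\<alpha> by simp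
      \<comment> \<open>Enlarging the factor x to x + 1/2 matches the argument of \<open>r\<close>,
        so the shifted limit applies.\<close>
      then have "x * \<bar>Re (G (x + 1/2))\<bar> \<le> (x + 1/2) * (2 * C * r (x + 1/2))"
        using elim(2) by (intro mult_mono) auto
      then have "x * \<bar>Re (G (x + 1/2))\<bar> / ln 2 \<le> (x + 1/2) * (2 * C * r (x + 1/2)) / ln 2"
        by (intro divide_right_mono) auto
      then show ?case
        using elim(2) by (simp add: FG abs_mult mult_ac)
    qed
  qed
  obtain t :: real where t: "\<And>s. Re s > 0 \<Longrightarrow> F s = s + \<i> * of_real t"
    using half_plane_rigidity[OF holF posF limF decayF] by blast
  have "\<phi> s = s + \<i> * of_real t" if "s \<in> half_plane (1/2)" for s
    using t[of "s - 1/2"] that by (simp add: F_def half_plane_def)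
  then show ?thesis by blast
qed

lemma recurrent_imp_translation:
  assumes hol: "\<phi> holomorphic_on half_plane (1/2)"
    and maps: "\<phi> ` half_plane (1/2) \<subseteq> half_plane (1/2)"
    and bdd: "comp_op_bounded \<phi>" and rec: "recurrent (comp_op \<phi>)"
  shows "\<exists>t::real. \<forall>s\<in>half_plane (1/2). \<phi> s = s + \<i> * of_real t"
proof -
  have H: "comp_maps_H \<phi>"
    using bdd by (simp add: comp_op_bounded_def)
  have b1: "comp_op \<phi> (dir_unit 2) 1 = 0"
    by (rule recurrent_imp_leading_coeff_0[OF assms])
  have "cmod (comp_op \<phi> (dir_unit 2) 2) = 1"
    by (rule recurrent_eigenvalue[OF H rec comp_op_coeff_2[OF H b1]])
  then show ?thesis
    by (rule translation_of_unimodular_coeff[OF hol maps H b1])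
qed

section \<open>Vertical translations\<close>

text \<open>A diagonal selection gives exponents along which all the powers converge simultaneously,
  to limits of modulus 1; quotients of two such powers then tend to 1.\<close>

lemma unimodular_powers_recurrent:
  fixes z :: "'a::countable \<Rightarrow> complex"
  assumes z: "\<And>n. cmod (z n) = 1"
  shows "\<exists>\<omega>. admissible_seq \<omega> \<and> (\<forall>n. (\<lambda>k. z n ^ \<omega> k) \<longlonglongrightarrow> 1)"
proof -
  obtain k :: "nat \<Rightarrow> nat" where k: "strict_mono k" "\<And>n. \<exists>l. (\<lambda>j. z n ^ k j) \<longlonglongrightarrow> l"
    by (rule function_convergent_subsequence[of UNIV "\<lambda>j n. z n ^ j" 1])
      (use z in \<open>auto simp: norm_power\<close>)
  \<comment> \<open>The indices j and 2j+1 are more than j apart, so these differences are positive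
    and unbounded.\<close>
  define \<delta> where "\<delta> j = k (2 * j + 1) - k j" for j
  have add_le: "k (j + d) \<ge> k j + d" for j d
  proof (induction d)
    case (Suc d)
    then show ?case
      using strict_monoD[OF k(1), of "j + d" "j + Suc d"] by simp
  qed simp
  have \<delta>_gt: "\<delta> j > j" for j
    using add_le[of j "j + 1"] by (simp add: \<delta>_def mult_2)
  \<comment> \<open>The differences need not increase with j. Feeding each one back as the next
    index selects an increasing subsequence.\<close>
  define r where "r j = (\<delta> ^^ j) 0" for j
  have r_Suc: "r (Suc j) = \<delta> (r j)" for j
    by (simp add: r_def)
  have r: "strict_mono r"
    by (rule strict_monoI_Suc) (simp add: r_Suc \<delta>_gt)
  have \<delta>r: "strict_mono (\<lambda>j. \<delta> (r j))"
    by (rule strict_monoI_Suc) (metis r_Suc \<delta>_gt)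
  have adm: "admissible_seq (\<lambda>j. \<delta> (r j))"
    using \<delta>r \<delta>_gt by (auto simp: admissible_seq_def intro: le_less_trans[OF le0])
  have lim: "(\<lambda>j. z n ^ \<delta> j) \<longlonglongrightarrow> 1" for n
  proof -
    obtain l where l: "(\<lambda>j. z n ^ k j) \<longlonglongrightarrow> l"
      using k(2) by blast
    have "(\<lambda>j. cmod (z n ^ k j)) \<longlonglongrightarrow> cmod l"
      by (intro tendsto_norm l)
    then have "cmod l = 1"
      using z by (simp add: norm_power LIMSEQ_const_iff)
    then have "l \<noteq> 0" by auto
    have "strict_mono (\<lambda>j::nat. 2 * j + 1)"
      by (rule strict_monoI) simp
    from LIMSEQ_subseq_LIMSEQ[OF l this] have "(\<lambda>j. z n ^ k (2 * j + 1)) \<longlonglongrightarrow> l"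
      by (simp add: o_def)
    then have "(\<lambda>j. z n ^ k (2 * j + 1) / z n ^ k j) \<longlonglongrightarrow> l / l"
      by (intro tendsto_divide l \<open>l \<noteq> 0\<close>)
    moreover have "z n ^ k (2 * j + 1) / z n ^ k j = z n ^ \<delta> j" for j
    proof -
      have "z n \<noteq> 0"
        using z[of n] by auto
      moreover have "k j \<le> k (2 * j + 1)"
        using add_le[of j "j + 1"] by (simp add: mult_2)
      ultimately show ?thesis
        by (simp add: \<delta>_def power_diff)
    qed
    ultimately show ?thesis
      using \<open>l \<noteq> 0\<close> by simp
  qed
  have "(\<lambda>j. z n ^ \<delta> (r j)) \<longlonglongrightarrow> 1" for n
    using LIMSEQ_subseq_LIMSEQ[OF lim r] by (simp add: o_def)
  with adm show ?thesis by blast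
qed

section \<open>Dense sets and coefficientwise convergence\<close>

lemma hdense_Hdir: "hdense Hdir"
  by (auto simp: hdense_def hnorm_def intro!: bexI)

lemma hdense_nonzero_coeffs: "hdense {x \<in> Hdir. \<forall>n>0. x n \<noteq> 0}"
  unfolding hdense_def
proof (intro conjI ballI allI impI)
  fix a and \<epsilon> :: real
  assume a: "a \<in> Hdir" and \<epsilon>: "\<epsilon> > 0"
  \<comment> \<open>Only vanishing coefficients are filled, with geometrically small entries: the
    squared norm is at most (\<epsilon>^2/4)(4/3) < \<epsilon>^2.\<close>
  define y where "y = (\<lambda>n. if n = 0 \<or> a n \<noteq> 0 then 0 else complex_of_real (\<epsilon> / 2 * (1/2) ^ n))"
  have le: "(cmod (y n))\<^sup>2 \<le> \<epsilon>\<^sup>2 / 4 * (1/4) ^ n" for n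
  proof (cases "n = 0 \<or> a n \<noteq> 0")
    case False
    then have y_eq: "cmod (y n) = \<epsilon> / 2 * (1/2) ^ n"
      using \<epsilon> by (simp only: y_def if_False norm_of_real) simp
    have "(cmod (y n))\<^sup>2 = \<epsilon>\<^sup>2 / 4 * (1/2 * (1/2)) ^ n"
      unfolding y_eq power_mult_distrib[of "1/2" "1/2"] by (simp add: power2_eq_square)
    then show ?thesis by simp
  qed (use \<epsilon> in \<open>auto simp: y_def\<close>)
  have geo: "(\<lambda>n. \<epsilon>\<^sup>2 / 4 * (1/4) ^ n) sums (\<epsilon>\<^sup>2 / 4 * (1 / (1 - 1/4)))"
    by (intro sums_mult geometric_sums) simp
  have sm: "summable (\<lambda>n. (cmod (y n))\<^sup>2)"
    by (rule summable_comparison_test'[OF sums_summable[OF geo], where N=0]) (use le in simp)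
  have y: "y \<in> Hdir"
    using sm by (simp add: Hdir_def y_def)
  have "(\<Sum>n. (cmod (y n))\<^sup>2) \<le> \<epsilon>\<^sup>2 / 4 * (1 / (1 - 1/4))"
    using suminf_le[OF le sm sums_summable[OF geo]] sums_unique[OF geo] by simp
  also have "\<dots> < \<epsilon>\<^sup>2"
    using \<epsilon> by simp
  finally have "hnorm y < \<epsilon>"
    unfolding hnorm_def using \<epsilon> by (simp add: real_less_lsqrt suminf_nonneg sm)
  moreover have "(\<lambda>n. a n + y n) \<in> {x \<in> Hdir. \<forall>n>0. x n \<noteq> 0}"
    using Hdir_add[OF a y] \<epsilon> by (auto simp: y_def)
  ultimately show "\<exists>x\<in>{x \<in> Hdir. \<forall>n>0. x n \<noteq> 0}. hnorm (\<lambda>n. x n - a n) < \<epsilon>"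
    by (intro bexI[of _ "\<lambda>n. a n + y n"]) auto
qed auto

lemma hdense_mono: "hdense S \<Longrightarrow> S \<subseteq> S' \<Longrightarrow> S' \<subseteq> Hdir \<Longrightarrow> hdense S'"
  unfolding hdense_def by (meson subsetD)

text \<open>The squared deviations are dominated by 4 |x_n|^2, so Tannery's theorem turns
  coefficientwise convergence into norm convergence.\<close>

lemma diagonal_iter_conv:
  assumes x: "x \<in> Hdir" and z: "\<And>n. cmod (z n) = 1"
    and T: "\<And>k n. (T ^^ k) x n = x n * z n ^ k"
    and lim: "\<And>n. (\<lambda>k. z n ^ \<omega> k) \<longlonglongrightarrow> 1"
  shows "iter_conv T \<omega> x"
proof -
  define f where "f = (\<lambda>n k. (cmod (x n * z n ^ \<omega> k - x n))\<^sup>2)"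
  have f_lim: "(\<lambda>k. f n k) \<longlonglongrightarrow> 0" for n
  proof -
    have "(\<lambda>k. (cmod (x n * z n ^ \<omega> k - x n))\<^sup>2) \<longlonglongrightarrow> (cmod (x n * 1 - x n))\<^sup>2"
      by (intro tendsto_intros lim)
    then show ?thesis by (simp add: f_def)
  qed
  have f_le: "norm (f n k) \<le> 4 * (cmod (x n))\<^sup>2" for n k
  proof -
    have "cmod (x n * z n ^ \<omega> k - x n) \<le> cmod (x n * z n ^ \<omega> k) + cmod (x n)"
      by (rule norm_triangle_ineq4)
    also have "\<dots> = 2 * cmod (x n)"
      by (simp add: norm_mult norm_power z)
    finally have "(cmod (x n * z n ^ \<omega> k - x n))\<^sup>2 \<le> (2 * cmod (x n))\<^sup>2"
      by (intro power_mono) auto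
    then show ?thesis
      by (simp add: f_def power_mult_distrib)
  qed
  have "(\<lambda>k. \<Sum>n. f n k) \<longlonglongrightarrow> (\<Sum>n. 0)"
    by (rule tannerys_theorem[where M = "\<lambda>n. 4 * (cmod (x n))\<^sup>2", THEN conjunct2, THEN conjunct2])
      (use f_lim f_le in \<open>auto intro!: summable_mult summable_Hdir x always_eventually\<close>)
  then have "(\<lambda>k. sqrt (\<Sum>n. f n k)) \<longlonglongrightarrow> sqrt 0"
    by (intro tendsto_real_sqrt) simp
  then show ?thesis
    by (simp add: iter_conv_def hnorm_def f_def T)
qed

text \<open>The translation multiplies the n-th coefficient by n^(-it). Common return times of these
  factors return every vector. Conversely, a vector without zero coefficients can return only along
  common return times, so it lies in \<open>Hr\<close>.\<close>

lemma translation_hyper_recurrent: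
  assumes H: "comp_maps_H \<phi>" and \<phi>: "\<And>s. s \<in> half_plane (1/2) \<Longrightarrow> \<phi> s = s + \<i> * of_real t"
  shows "recurrent (comp_op \<phi>)" "hdense (Hr (comp_op \<phi>))"
proof -
  define T where "T = comp_op \<phi>"
  \<comment> \<open>At n = 0 the convention \<open>ln 0 = 0\<close> gives \<open>z 0 = 1\<close>, so
    the factors are unimodular at every index.\<close>
  define z where "z = (\<lambda>n::nat. exp (- (\<i> * of_real (t * ln (real n)))))"
  have z: "cmod (z n) = 1" for n
    by (simp add: z_def)
  have T1: "T a = (\<lambda>n. a n * z n)" if a: "a \<in> Hdir" for a
    unfolding T_def
  proof (rule comp_op_eqI[OF H a])
    show "(\<lambda>n. a n * z n) \<in> Hdir"
      by (rule Hdir_bounded_by[OF a]) (simp add: norm_mult z)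
    fix s assume "s \<in> half_plane (1/2)"
    have "a n * z n * of_nat n powr (- s) = a n * of_nat n powr (- \<phi> s)" for n
    proof (cases "n = 0")
      case False
      then have "Ln (of_nat n) = of_real (ln (real n))"
        using Ln_of_real[of "real n"] by simp
      then show ?thesis
        using False \<open>s \<in> _\<close>
        by (simp add: \<phi> z_def powr_def algebra_simps flip: exp_add)
    qed (simp add: Hdir_0[OF a])
    then show "dir_eval (\<lambda>n. a n * z n) s = dir_eval a (\<phi> s)"
      by (simp only: dir_eval_def)
  qed
  have Tk: "(T ^^ k) a n = a n * z n ^ k" if a: "a \<in> Hdir" for a k n
  proof (induction k arbitrary: n)
    case (Suc k)
    have "(T ^^ Suc k) a = (\<lambda>n. (T ^^ k) a n * z n)"
      using T1[OF comp_op_funpow_Hdir[OF H a, of k]] by (simp add: T_def)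
    then show ?case
      using Suc by (simp add: mult_ac)
  qed simp
  have conv: "Lset T \<omega> = Hdir" if "\<And>n. (\<lambda>k. z n ^ \<omega> k) \<longlonglongrightarrow> 1" for \<omega>
    using diagonal_iter_conv[OF _ z Tk that] by (auto simp: Lset_def)
  obtain \<omega>0 where \<omega>0: "admissible_seq \<omega>0" "\<And>n. (\<lambda>k. z n ^ \<omega>0 k) \<longlonglongrightarrow> 1"
    using unimodular_powers_recurrent[of z, OF z] by blast
  have Rec: "Rec T = Hdir"
    using conv[OF \<omega>0(2)] \<omega>0(1) by (auto simp: Rec_def Lset_def)
  then show "recurrent (comp_op \<phi>)"
    using hdense_Hdir by (simp add: recurrent_def T_def)
  have "{x \<in> Hdir. \<forall>n>0. x n \<noteq> 0} \<subseteq> Hr T"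
  proof clarify
    fix x assume x: "x \<in> Hdir" "\<forall>n>0. x n \<noteq> 0"
    have "hdense (Lset T \<omega>)" if "x \<in> Lset T \<omega>" for \<omega>
    proof -
      have "(\<lambda>k. z n ^ \<omega> k) \<longlonglongrightarrow> 1" for n
      proof (cases "n = 0")
        case False
        then have nz: "x n \<noteq> 0" using x(2) by simp
        have "(\<lambda>k. (T ^^ \<omega> k) x n) \<longlonglongrightarrow> x n"
          using that iter_conv_coeff[OF H x(1)] by (auto simp: Lset_def T_def)
        then have "(\<lambda>k. x n * z n ^ \<omega> k / x n) \<longlonglongrightarrow> x n / x n"
          unfolding Tk[OF x(1)] by (intro tendsto_divide tendsto_const nz)
        then show ?thesis
          using nz by simp
      qed (simp add: z_def)
      from conv[OF this] show ?thesis
        using hdense_Hdir by simp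
    qed
    then show "x \<in> Hr T"
      using x(1) Rec by (auto simp: Hr_def)
  qed
  then show "hdense (Hr (comp_op \<phi>))"
    using hdense_mono[OF hdense_nonzero_coeffs] Rec by (auto simp: Hr_def T_def)
qed

theorem theorem5p21:
  fixes \<phi> :: "complex \<Rightarrow> complex"
  assumes "\<phi> holomorphic_on half_plane (1/2)"
    and "\<phi> ` half_plane (1/2) \<subseteq> half_plane (1/2)"
    and "comp_op_bounded \<phi>"
  shows "(recurrent (comp_op \<phi>) \<longleftrightarrow>
           (\<exists>t::real. \<forall>s\<in>half_plane (1/2). \<phi> s = s + \<i> * of_real t))
       \<and> (recurrent (comp_op \<phi>) \<longrightarrow>
           hyper_recurrent (comp_op \<phi>) \<and> hdense (Hr (comp_op \<phi>)))"
proof -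
  have H: "comp_maps_H \<phi>"
    using assms(3) by (simp add: comp_op_bounded_def)
  have iff: "recurrent (comp_op \<phi>) \<longleftrightarrow>
      (\<exists>t::real. \<forall>s\<in>half_plane (1/2). \<phi> s = s + \<i> * of_real t)"
    using recurrent_imp_translation[OF assms] translation_hyper_recurrent(1)[OF H] by blast
  have "hyper_recurrent (comp_op \<phi>) \<and> hdense (Hr (comp_op \<phi>))" if rec: "recurrent (comp_op \<phi>)"
  proof -
    have "hdense (Hr (comp_op \<phi>))"
      using rec iff translation_hyper_recurrent(2)[OF H] by blast
    moreover from this have "Hr (comp_op \<phi>) \<noteq> {}"
      using hdense_coeff[OF _ dir_unit_Hdir, of _ 1 1] by force
    ultimately show ?thesis
      using rec by (simp add: hyper_recurrent_def)
  qed
  with iff show ?thesis by blast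
qed

end
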